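(* Let $P=UU^T\in\mathrm{Gr}(n,p)$ and $F=YY^T\in\mathrm{Gr}(n,p)\setminus\mathrm{Cut}_P$ with $U,Y\in\mathrm{St}(n,p)$. Perform the following procedure (the Extended Grassmann Logarithm): 1. compute an SVD $Y^TU=\widetilde Q\widetilde S\widetilde R^T$ (with $\widetilde Q,\widetilde R\in\mathrm{O}(p)$); 2. set $Y_*:=Y\widetilde Q\widetilde R^T$; 3. compute a compact SVD $(I_n-UU^T)Y_*=\hat Q\hat S R^T$; 4. set $\Sigma:=\arcsin(\hat S)$, applied entrywise on the diagonal; 5. output $\hat Q\Sigma R^T$. Then the output $\hat Q\Sigma R^T$ is the horizontal lift $\Delta^{\mathsf{hor}}_U\in\mathrm{Hor}_U\mathrm{St}(n,p)$ of the Riemannian (Grassmann) logarithm $\Delta=\mathrm{Log}^{\mathrm{Gr}}_P(F)\in T_P\mathrm{Gr}(n,p)$. Moreover the Stiefel representative $Y_*$ is retained by the Grassmann exponential on the level of Stiefel representatives, i.e. $Y_*=\mathrm{Exp}^{\mathrm{Gr}}_U(\Delta^{\mathsf{hor}}_U)$.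
   Context: Let $1\le p\le n$ be integers. $\mathrm{St}(n,p)=\{U\in\mathbb{R}^{n\times p}: U^TU=I_p\}$. $\mathrm{Gr}(n,p)=\{P\in\mathbb{R}^{n\times n}: P^T=P,\ P^2=P,\ \mathrm{rank}\,P=p\}$, an embedded submanifold of the symmetric $n\times n$ matrices, with tangent space $T_P\mathrm{Gr}(n,p)=\{\Delta=\Delta^T: \Delta P+P\Delta=\Delta\}$ and Riemannian metric $g_P(\Delta_1,\Delta_2)=\frac12\mathrm{tr}(\Delta_1\Delta_2)$, with induced norm $\|\cdot\|$. For $P=UU^T$ with $U\in\mathrm{St}(n,p)$, the horizontal lift of $\Delta\in T_P\mathrm{Gr}(n,p)$ to $U$ is $\Delta^{\mathsf{hor}}_U:=\Delta U\in\mathrm{Hor}_U\mathrm{St}(n,p):=\{D\in\mathbb{R}^{n\times p}: U^TD=0\}$; this is a linear bijection $T_P\mathrm{Gr}(n,p)\to\mathrm{Hor}_U\mathrm{St}(n,p)$. $\mathrm{Exp}^{\mathrm{Gr}}_P:T_P\mathrm{Gr}(n,p)\to\mathrm{Gr}(n,p)$ is the Riemannian exponential map; explicitly $\mathrm{Exp}^{\mathrm{Gr}}_P(\Delta)=\exp_m([\Delta,P])\,P\,\exp_m(-[\Delta,P])$, with $\exp_m$ the matrix exponential and $[A,B]=AB-BA$. A compact SVD of $X\in\mathbb{R}^{n\times p}$ is $X=Q\Sigma V^T$ with $Q\in\mathrm{St}(n,p)$, $\Sigma\in\mathbb{R}^{p\times p}$ diagonal with nonnegative entries, $V\in\mathrm{O}(p)$.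 The Grassmann exponential on the level of Stiefel representatives is $\mathrm{Exp}^{\mathrm{Gr}}_U(\Delta^{\mathsf{hor}}_U):=UV\cos(\Sigma)V^T+Q\sin(\Sigma)V^T\in\mathrm{St}(n,p)$, where $\Delta^{\mathsf{hor}}_U=Q\Sigma V^T$ is a compact SVD and $\cos,\sin$ act entrywise on the diagonal. For nonzero $\Delta\in T_P\mathrm{Gr}(n,p)$ the cut time is $t_{\mathrm{cut}}(P,\Delta)=\sup\{b>0: t\mapsto\mathrm{Exp}^{\mathrm{Gr}}_P(t\Delta)\text{ restricted to }[0,b]\text{ is length-minimizing}\}$; the cut locus $\mathrm{Cut}_P$ is the set of all points $\mathrm{Exp}^{\mathrm{Gr}}_P(t_{\mathrm{cut}}(P,\Delta)\Delta)$. It is known that $\mathrm{Cut}_P=\{YY^T\in\mathrm{Gr}(n,p): Y\in\mathrm{St}(n,p),\ \mathrm{rank}(U^TY)<p\}$. The injectivity domain is $\mathrm{ID}_P=\{\Delta\in T_P\mathrm{Gr}(n,p): \|\Delta\|<t_{\mathrm{cut}}(P,\Delta/\|\Delta\|)\}$ (including $\Delta=0$). $\mathrm{Exp}^{\mathrm{Gr}}_P$ restricts to a diffeomorphism $\mathrm{ID}_P\to\mathrm{Gr}(n,p)\setminus\mathrm{Cut}_P$, and for $F\notin\mathrm{Cut}_P$ the Riemannian logarithm $\mathrm{Log}^{\mathrm{Gr}}_P(F)$ is the unique $\Delta\in\mathrm{ID}_P$ with $\mathrm{Exp}^{\mathrm{Gr}}_P(\Delta)=F$. *)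

theory Defs
  imports "HOL-Analysis.Analysis"
begin

section \<open>Matrix functions and singular value decompositions\<close>

(* The type class operations "times", "power" and "exp" are not usable here: the product of
   HOL-Analysis vectors is componentwise, hence so would be the powers of a matrix. *)
primrec mpow :: "real^'n^'n \<Rightarrow> nat \<Rightarrow> real^'n^'n" where
  "mpow A 0 = mat 1"
| "mpow A (Suc k) = A ** mpow A k"

definition mexp :: "real^'n^'n \<Rightarrow> real^'n^'n" where
  "mexp A = (\<Sum>k. mpow A k /\<^sub>R fact k)"

definition commutator :: "real^'n^'n \<Rightarrow> real^'n^'n \<Rightarrow> real^'n^'n" where
  "commutator A B = A ** B - B ** A"

(* f acts on the diagonal only; off-diagonal entries stay 0 even if f 0 is not 0 (as for cos). *)
definition diag_map :: "(real \<Rightarrow> real) \<Rightarrow> real^'p^'p \<Rightarrow> real^'p^'p" where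
  "diag_map f S = (\<chi> i j. if i = j then f (S $ i $ i) else 0)"

definition nonneg_diagonal :: "real^'p^'p \<Rightarrow> bool" where
  "nonneg_diagonal S \<longleftrightarrow> (\<forall>i j. i \<noteq> j \<longrightarrow> S $ i $ j = 0) \<and> (\<forall>i. 0 \<le> S $ i $ i)"

definition Stiefel :: "(real^'p^'n) set" where
  "Stiefel = {U. transpose U ** U = mat 1}"

(* SVDs are not unique, so both notions are relations; the singular values are not required to
   be sorted. *)
definition is_svd :: "real^'p^'p \<Rightarrow> real^'p^'p \<Rightarrow> real^'p^'p \<Rightarrow> real^'p^'p \<Rightarrow> bool" where
  "is_svd X Q S V \<longleftrightarrow>
     orthogonal_matrix Q \<and> nonneg_diagonal S \<and> orthogonal_matrix V \<and> X = Q ** S ** transpose V"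

definition is_compact_svd :: "real^'p^'n \<Rightarrow> real^'p^'n \<Rightarrow> real^'p^'p \<Rightarrow> real^'p^'p \<Rightarrow> bool" where
  "is_compact_svd X Q S V \<longleftrightarrow>
     Q \<in> Stiefel \<and> nonneg_diagonal S \<and> orthogonal_matrix V \<and> X = Q ** S ** transpose V"

section \<open>The Grassmann manifold\<close>

definition Grassmann :: "nat \<Rightarrow> (real^'n^'n) set" where
  "Grassmann p = {P. transpose P = P \<and> P ** P = P \<and> rank P = p}"

definition Gr_tangent :: "real^'n^'n \<Rightarrow> (real^'n^'n) set" where
  "Gr_tangent P = {D. transpose D = D \<and> D ** P + P ** D = D}"

definition Gr_metric :: "real^'n^'n \<Rightarrow> real^'n^'n \<Rightarrow> real" where
  "Gr_metric D1 D2 = (1/2) * trace (D1 ** D2)"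

definition Gr_norm :: "real^'n^'n \<Rightarrow> real" where
  "Gr_norm D = sqrt (Gr_metric D D)"

definition St_horizontal :: "real^'p^'n \<Rightarrow> (real^'p^'n) set" where
  "St_horizontal U = {D. transpose U ** D = 0}"

definition horizontal_lift :: "real^'p^'n \<Rightarrow> real^'n^'n \<Rightarrow> real^'p^'n" where
  "horizontal_lift U D = D ** U"

definition Gr_exp :: "real^'n^'n \<Rightarrow> real^'n^'n \<Rightarrow> real^'n^'n" where
  "Gr_exp P D = mexp (commutator D P) ** P ** mexp (- commutator D P)"

(* The value does not depend on the compact SVD. The description operator incorporates this: it
   denotes the common value of the formula over all compact SVDs of the horizontal vector D. *)
definition St_exp :: "real^'p^'n \<Rightarrow> real^'p^'n \<Rightarrow> real^'p^'n" where
  "St_exp U D = (THE Y. \<exists>Q S V. is_compact_svd D Q S V \<and>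
     Y = U ** V ** diag_map cos S ** transpose V + Q ** diag_map sin S ** transpose V)"

section \<open>Length, cut locus and Riemannian logarithm\<close>

(* The library's piecewise C1 functions may have an unbounded derivative at the breakpoints. Curves
   of infinite length are excluded explicitly, since the integral of a non-integrable speed would
   be 0 by convention. *)
definition Gr_curve :: "nat \<Rightarrow> real \<Rightarrow> (real \<Rightarrow> real^'n^'n) \<Rightarrow> bool" where
  "Gr_curve p b c \<longleftrightarrow>
     c piecewise_C1_differentiable_on {0..b} \<and> c ` {0..b} \<subseteq> Grassmann p \<and>
     (\<lambda>t. Gr_norm (vector_derivative c (at t))) integrable_on {0..b}"

definition Gr_length :: "real \<Rightarrow> (real \<Rightarrow> real^'n^'n) \<Rightarrow> real" where
  "Gr_length b c = integral {0..b} (\<lambda>t. Gr_norm (vector_derivative c (at t)))"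

definition length_minimizing :: "nat \<Rightarrow> real \<Rightarrow> (real \<Rightarrow> real^'n^'n) \<Rightarrow> bool" where
  "length_minimizing p b c \<longleftrightarrow> Gr_curve p b c \<and>
     (\<forall>d. Gr_curve p b d \<and> d 0 = c 0 \<and> d b = c b \<longrightarrow> Gr_length b c \<le> Gr_length b d)"

(* For P in Grassmann p the manifold is recovered from P, as p = rank P. *)
definition cut_time :: "real^'n^'n \<Rightarrow> real^'n^'n \<Rightarrow> real" where
  "cut_time P D = Sup {b. b > 0 \<and> length_minimizing (rank P) b (\<lambda>t. Gr_exp P (t *\<^sub>R D))}"

definition cut_locus :: "real^'n^'n \<Rightarrow> (real^'n^'n) set" where
  "cut_locus P = {Gr_exp P (cut_time P D *\<^sub>R D) | D. D \<in> Gr_tangent P \<and> D \<noteq> 0}"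

definition injectivity_domain :: "real^'n^'n \<Rightarrow> (real^'n^'n) set" where
  "injectivity_domain P =
     {D \<in> Gr_tangent P. D = 0 \<or> Gr_norm D < cut_time P (D /\<^sub>R Gr_norm D)}"

definition Gr_log :: "real^'n^'n \<Rightarrow> real^'n^'n \<Rightarrow> real^'n^'n" where
  "Gr_log P F = (THE D. D \<in> injectivity_domain P \<and> Gr_exp P D = F)"

end

theory Submission
  imports Defs
begin

text \<open>Let \<open>\<theta>\<close> be the principal angles between \<open>U\<close> and \<open>Y\<close>. In terms of aligned orthonormal bases the geodesic is
  \<open>U cos(t\<theta>) + Q sin(t\<theta>)\<close>, with speed \<open>\<parallel>\<theta>\<parallel>\<close>. Everything hinges on the cut time, which is
  \<open>\<pi> / 2\<close> divided by the largest angle. A longer geodesic is not minimizing, since its angles can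
  be reduced modulo \<open>\<pi>\<close>. Conversely, lift a competing curve horizontally: the \<open>i\<close>-th column then
  moves on the sphere from \<open>u\<^sub>i\<close> to the \<open>i\<close>-th column of \<open>Y O\<close> for some orthogonal \<open>O\<close>, whose inner
  product with \<open>u\<^sub>i\<close> is \<open>cos \<theta>\<^sub>i O\<^sub>i\<^sub>i \<le> cos \<theta>\<^sub>i\<close>; so it travels at least the angle \<open>\<theta>\<^sub>i\<close>, and Minkowski's
  inequality bounds the length from below by \<open>\<parallel>\<theta>\<parallel>\<close>. Hence the injectivity domain consists of the
  tangent vectors with all angles below \<open>\<pi> / 2\<close>, on which the sines and cosines determine the angles
  by functional calculus.\<close>

section \<open>Matrix algebra\<close>

text \<open>\<open>cut_time\<close> speaks of minimality among all piecewise C1 curves, and a smooth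
  horizontal lift would mean solving a differential equation across breakpoints. The lift is
  therefore made at finitely many times: on each piece the chord between projectors is compared with
  the arc, and the total error is a factor 2 / (2 - \<eta>), independent of the number of pieces,
  which tends to 1 with the mesh. The other obstacle is that decompositions are not unique: bases
  may differ by permutations and by rotations within equal singular values, and columns for the
  value 0 are almost arbitrary. Bases are thus never compared, only matrices V f(S) V^T, and Q f(S)
  V^T with f 0 = 0, which depend on the decomposed matrix alone. This suffices, as sin and arcsin
  vanish at 0 and cos occurs only between V and V^T.\<close>

lemma bounded_bilinear_matrix_mul:
  "bounded_bilinear ((**) :: real^'n^'m \<Rightarrow> real^'p^'n \<Rightarrow> real^'p^'m)"
  unfolding bilinear_conv_bounded_bilinear[symmetric] bilinear_def linear_iff
  by (auto simp: matrix_matrix_mult_def vec_eq_iff sum.distrib sum_distrib_left algebra_simps)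

interpretation matrix_mul: bounded_bilinear "(**) :: real^'n^'m \<Rightarrow> real^'p^'n \<Rightarrow> real^'p^'m"
  by (rule bounded_bilinear_matrix_mul)

lemma bounded_linear_transpose: "bounded_linear (transpose :: real^'n^'m \<Rightarrow> real^'m^'n)"
  unfolding linear_conv_bounded_linear[symmetric] linear_iff
  by (auto simp: transpose_def vec_eq_iff)

lemmas transpose_add = linear_add[OF bounded_linear.linear[OF bounded_linear_transpose]]
  and transpose_diff = linear_diff[OF bounded_linear.linear[OF bounded_linear_transpose]]
  and transpose_minus = linear_neg[OF bounded_linear.linear[OF bounded_linear_transpose]]

lemma transpose_mul_nth:
  fixes A :: "real^'p^'n" and B :: "real^'q^'n"
  shows "(transpose A ** B) $ i $ j = column i A \<bullet> column j B"
  by (simp add: matrix_matrix_mult_def transpose_def column_def inner_vec_def)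

lemma trace_transpose_mul:
  fixes A B :: "real^'p^'n"
  shows "trace (transpose A ** B) = A \<bullet> B"
  unfolding trace_def matrix_matrix_mult_def transpose_def inner_vec_def vec_lambda_beta inner_real_def
  by (rule sum.swap)

text \<open>Indexed by a function, so that applying cos, sin or arcsin to singular values is plain
  composition.\<close>

definition diagm :: "('p::finite \<Rightarrow> real) \<Rightarrow> real^'p^'p" where
  "diagm s = (\<chi> i j. if i = j then s i else 0)"

lemma diagm_nth [simp]: "diagm s $ i $ j = (if i = j then s i else 0)"
  by (simp add: diagm_def)

lemma mul_diagm_nth: "(A ** diagm s) $ i $ j = A $ i $ j * s j"
  by (simp add: matrix_matrix_mult_def if_distrib[of "(*) _"] cong: if_cong)

lemma diagm_mul_nth: "(diagm s ** A) $ i $ j = s i * A $ i $ j"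
  by (simp add: matrix_matrix_mult_def if_distribR cong: if_cong)
     (simp add: if_distrib[of "\<lambda>x. x * _"] cong: if_cong)

lemma diagm_mult: "diagm a ** diagm b = diagm (\<lambda>i. a i * b i)"
  by (simp add: vec_eq_iff mul_diagm_nth)

lemma diagm_mult_assoc: "diagm a ** (diagm b ** X) = diagm (\<lambda>i. a i * b i) ** X"
  by (simp add: matrix_mul_assoc diagm_mult)

lemma transpose_diagm [simp]: "transpose (diagm s) = diagm s"
  by (simp add: vec_eq_iff transpose_def)

lemma diagm_one: "diagm (\<lambda>_. 1) = mat 1"
  by (simp add: vec_eq_iff mat_def)

lemma diagm_add: "diagm a + diagm b = diagm (\<lambda>i. a i + b i)"
  by (simp add: vec_eq_iff)

lemma scaleR_diagm: "c *\<^sub>R diagm a = diagm (\<lambda>i. c * a i)"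
  by (simp add: vec_eq_iff)

lemma trace_diagm: "trace (diagm s) = sum s UNIV"
  by (simp add: trace_def)

lemma column_mul_diagm: "column j (A ** diagm s) = s j *\<^sub>R column j A"
  by (simp add: vec_eq_iff column_def mul_diagm_nth)

lemma column_mul: "column j (A ** B) = A *v column j B"
  by (simp add: vec_eq_iff column_def matrix_matrix_mult_def matrix_vector_mult_def)

lemma column_add: "column j (A + B) = column j A + column j B"
  by (simp add: vec_eq_iff column_def)

lemma matrix_eq_columns: "(\<And>j. column j A = column j B) \<Longrightarrow> A = B"
  by (simp add: vec_eq_iff column_def)

lemma nonneg_diagonal_eq_diagm:
  assumes "nonneg_diagonal S"
  shows "S = diagm (\<lambda>i. S $ i $ i)"
  using assms by (auto simp: nonneg_diagonal_def vec_eq_iff)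

lemma diag_map_diagm: "diag_map f (diagm s) = diagm (\<lambda>i. f (s i))"
  by (simp add: diag_map_def vec_eq_iff)

lemma orthogonal_matrix_cancel:
  fixes V :: "real^'p^'p"
  assumes "orthogonal_matrix V"
  shows "transpose V ** V = mat 1" "V ** transpose V = mat 1"
    "transpose V ** (V ** X) = X" "V ** (transpose V ** X) = X"
  using assms by (auto simp: orthogonal_matrix_def matrix_mul_assoc)

lemma Stiefel_cancel:
  assumes "U \<in> Stiefel"
  shows "transpose U ** U = mat 1" "transpose U ** (U ** X) = X"
  using assms by (auto simp: Stiefel_def matrix_mul_assoc)

lemma Stiefel_mul_orthogonal:
  assumes "U \<in> Stiefel" "orthogonal_matrix V"
  shows "U ** V \<in> Stiefel"
  using assms by (simp add: Stiefel_def matrix_transpose_mul matrix_mul_assoc[symmetric]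
      Stiefel_cancel(2)[OF assms(1)] orthogonal_matrix_cancel[OF assms(2)])

section \<open>The spectral theorem for real symmetric matrices\<close>

lemma symmetric_inner:
  fixes A :: "real^'p^'p"
  assumes "transpose A = A"
  shows "x \<bullet> (A *v y) = (A *v x) \<bullet> y"
  using assms by (metis dot_lmul_matrix transpose_matrix_vector)

text \<open>A maximizer \<open>v\<close> of the quadratic form on the unit sphere of
  \<open>T\<close> is an eigenvector: otherwise the residual \<open>w\<close>, which lies in
  \<open>T\<close> and is orthogonal to \<open>v\<close>, would be a direction of increase.\<close>

lemma invariant_subspace_eigenvector:
  fixes A :: "real^'p^'p"
  assumes sym: "transpose A = A" and T: "subspace T" "T \<noteq> {0}"
    and inv: "\<And>x. x \<in> T \<Longrightarrow> A *v x \<in> T"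
  obtains v l where "v \<in> T" "norm v = 1" "A *v v = l *\<^sub>R v"
proof -
  define K where "K = sphere 0 1 \<inter> T"
  obtain x where x: "x \<in> T" "x \<noteq> 0"
    using T subspace_0 by blast
  then have "x /\<^sub>R norm x \<in> K"
    by (simp add: K_def subspace_scale[OF T(1)])
  moreover have "compact K"
    unfolding K_def by (intro compact_Int_closed closed_subspace T compact_sphere)
  moreover have "continuous_on K (\<lambda>x. x \<bullet> (A *v x))"
    by (intro continuous_intros linear_continuous_on matrix_vector_mul_bounded_linear)
  ultimately obtain v where v: "v \<in> K" and max: "\<And>y. y \<in> K \<Longrightarrow> y \<bullet> (A *v y) \<le> v \<bullet> (A *v v)"
    by (metis continuous_attains_sup empty_iff)
  define l where "l = v \<bullet> (A *v v)"
  have vT: "v \<in> T" and nv: "norm v = 1" using v by (auto simp: K_def)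
  have bound: "y \<bullet> (A *v y) \<le> l * (y \<bullet> y)" if "y \<in> T" for y
  proof (cases "y = 0")
    case False
    then have "y /\<^sub>R norm y \<in> K"
      using that by (simp add: K_def subspace_scale[OF T(1)])
    from max[OF this] have "(y \<bullet> (A *v y)) / (norm y * norm y) \<le> l"
      by (simp add: l_def matrix_vector_mult_scaleR divide_inverse mult_ac)
    then show ?thesis
      using False by (simp add: divide_le_eq power2_norm_eq_inner[symmetric] power2_eq_square)
  qed simp
  have vv: "v \<bullet> v = 1"
    using nv by (simp add: norm_eq_1)
  define w where "w = A *v v - l *\<^sub>R v"
  have wT: "w \<in> T"
    unfolding w_def by (intro subspace_diff subspace_scale T inv vT)
  have vw: "v \<bullet> w = 0"
    by (simp add: w_def l_def inner_diff_right vv)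
  have wAv: "w \<bullet> (A *v v) = w \<bullet> w"
    using vw by (simp add: w_def inner_diff_right inner_diff_left inner_commute)
  have vAw: "v \<bullet> (A *v w) = w \<bullet> w"
    using symmetric_inner[OF sym, of v w] wAv by (simp add: inner_commute)
  define c where "c = \<bar>w \<bullet> (A *v w) - l * (w \<bullet> w)\<bar>"
  \<comment> \<open>At v + t w the linear term 2 t |w|^2 must be absorbed by terms of order t^2,
    whose coefficient is at most \<open>c\<close>.\<close>
  have ineq: "2 * (w \<bullet> w) \<le> t * c" if "t > 0" for t
  proof -
    have "(v + t *\<^sub>R w) \<bullet> (A *v (v + t *\<^sub>R w)) \<le> l * ((v + t *\<^sub>R w) \<bullet> (v + t *\<^sub>R w))"
      by (intro bound subspace_add subspace_scale T vT wT)
    then have "l + 2 * t * (w \<bullet> w) + t * t * (w \<bullet> (A *v w)) \<le> l * (1 + t * t * (w \<bullet> w))"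
      by (simp add: matrix_vector_right_distrib matrix_vector_mult_scaleR inner_add_left
          inner_add_right wAv vAw vv vw inner_commute[of w v] algebra_simps l_def)
    then have "t * (2 * (w \<bullet> w)) \<le> t * (t * (l * (w \<bullet> w) - w \<bullet> (A *v w)))"
      by (simp add: algebra_simps)
    then have "2 * (w \<bullet> w) \<le> t * (l * (w \<bullet> w) - w \<bullet> (A *v w))"
      using that by (simp only: mult_le_cancel_left_pos)
    also have "\<dots> \<le> t * c"
      using that by (intro mult_left_mono) (auto simp: c_def)
    finally show ?thesis .
  qed
  have "w \<bullet> w = 0"
  proof (rule ccontr)
    assume "w \<bullet> w \<noteq> 0"
    then have pos: "w \<bullet> w > 0" by (metis inner_gt_zero_iff inner_eq_zero_iff)
    have c: "c \<ge> 0" by (simp add: c_def)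
    \<comment> \<open>This t makes t c at most |w|^2; the 1 keeps the denominator positive.\<close>
    have "2 * (w \<bullet> w) \<le> (w \<bullet> w) / (c + 1) * c"
      using pos c by (intro ineq) simp
    also have "\<dots> = (w \<bullet> w) * (c / (c + 1))" by simp
    also have "\<dots> \<le> (w \<bullet> w) * 1"
      using pos c by (intro mult_left_mono) auto
    finally show False using pos by simp
  qed
  then have "A *v v = l *\<^sub>R v"
    by (simp add: w_def)
  with vT nv show ?thesis by (rule that)
qed

text \<open>An orthonormal set of eigenvectors of maximal cardinality must span: otherwise its
  orthogonal complement is a nonzero invariant subspace and supplies one more.\<close>

theorem symmetric_matrix_diagonalizable:
  fixes A :: "real^'p^'p"
  assumes sym: "transpose A = A"
  obtains V s where "orthogonal_matrix V" "A = V ** diagm s ** transpose V"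
proof -
  define good where "good B \<longleftrightarrow> pairwise orthogonal B \<and>
    (\<forall>v\<in>B. norm v = 1 \<and> (\<exists>l. A *v v = l *\<^sub>R v))" for B :: "(real^'p) set"
  have ind: "independent B" if "good B" for B
  proof (rule pairwise_orthogonal_independent)
    show "pairwise orthogonal B" using that unfolding good_def by blast
    show "0 \<notin> B"
    proof
      assume "0 \<in> B"
      then have "norm (0 :: real^'p) = 1" using that unfolding good_def by blast
      then show False by simp
    qed
  qed
  have "card B < Suc DIM(real^'p)" if "good B" for B
    using independent_bound[OF ind[OF that]] by simp
  then have "\<exists>B. good B \<and> (\<forall>C. good C \<longrightarrow> card C \<le> card B)"
    by (intro Lattices_Big.ex_has_greatest_nat[where k = "{}" and b = "Suc DIM(real^'p)"])
       (auto simp: good_def)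
  then obtain B where B: "good B" and maxB: "\<And>C. good C \<Longrightarrow> card C \<le> card B"
    by blast
  have finB: "finite B"
    using independent_bound[OF ind[OF B]] by simp
  have "span B = UNIV"
  proof (rule ccontr)
    assume "span B \<noteq> UNIV"
    then obtain a where a: "a \<noteq> 0" "\<forall>x\<in>span B. a \<bullet> x = 0"
      using span_not_UNIV_orthogonal by blast
    define T where "T = {x. \<forall>v\<in>B. v \<bullet> x = 0}"
    have subT: "subspace T"
      by (auto simp: T_def subspace_def inner_add_right)
    have "a \<in> T"
      using a(2) span_base[of _ B] by (simp add: T_def inner_commute)
    then have "T \<noteq> {0}"
      using a(1) by blast
    have inv: "A *v x \<in> T" if "x \<in> T" for x
      unfolding T_def
    proof (intro CollectI ballI)
      fix v assume v: "v \<in> B"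
      then obtain l where "A *v v = l *\<^sub>R v" using B unfolding good_def by blast
      then show "v \<bullet> (A *v x) = 0"
        using symmetric_inner[OF sym, of v x] that v by (simp add: T_def)
    qed
    obtain v l where v: "v \<in> T" "norm v = 1" "A *v v = l *\<^sub>R v"
      using invariant_subspace_eigenvector[OF sym subT \<open>T \<noteq> {0}\<close> inv] by blast
    have "v \<notin> B"
      using v by (auto simp: T_def)
    moreover have "good (insert v B)"
    proof -
      have "\<forall>w\<in>B. orthogonal v w \<and> orthogonal w v"
        using v(1) by (simp add: T_def orthogonal_def inner_commute)
      then have "pairwise orthogonal (insert v B)"
        using B unfolding good_def pairwise_insert by blast
      then show ?thesis
        using B v(2,3) unfolding good_def by blast
    qed
    ultimately show False
      using maxB[of "insert v B"] finB by simp
  qed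
  then have "card B = CARD('p)"
    using dim_eq_card_independent[OF ind[OF B]] dim_span[of B] by simp
  then obtain h :: "'p \<Rightarrow> real^'p" where h: "bij_betw h UNIV B"
    using finite_same_card_bij[of "UNIV :: 'p set" B] finB by auto
  then have hB: "h j \<in> B" for j by (auto simp: bij_betw_def)
  have "\<forall>j. \<exists>l. A *v h j = l *\<^sub>R h j"
    using B hB unfolding good_def by blast
  then obtain s where s: "A *v h j = s j *\<^sub>R h j" for j by metis
  define V :: "real^'p^'p" where "V = (\<chi> i j. h j $ i)"
  have col: "column j V = h j" for j
    by (simp add: V_def column_def vec_eq_iff)
  have "h i \<bullet> h j = (if i = j then 1 else 0)" for i j
  proof (cases "i = j")
    case True
    then show ?thesis
      using B hB[of i] by (simp add: good_def norm_eq_1)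
  next
    case False
    then have "h i \<noteq> h j"
      using bij_betw_imp_inj_on[OF h] by (simp add: inj_eq)
    then show ?thesis
      using B hB[of i] hB[of j] False by (simp add: good_def pairwise_def orthogonal_def)
  qed
  then have V: "orthogonal_matrix V"
    by (simp add: orthogonal_matrix vec_eq_iff transpose_mul_nth col mat_def)
  have "A ** V = V ** diagm s"
    by (rule matrix_eq_columns) (simp add: column_mul[of _ A] column_mul_diagm col s)
  then have "A = V ** diagm s ** transpose V"
    using V by (metis orthogonal_matrix_def matrix_mul_assoc matrix_mul_rid)
  with V show ?thesis by (rule that)
qed

text \<open>The change of basis \<open>X\<close> = W^T V intertwines both diagonal matrices, so X_ij
  vanishes unless a_j = b_i. It then intertwines any \<open>f\<close> and \<open>g\<close> that
  agree wherever the eigenvalues do. No row of \<open>X\<close> is zero, which puts each b_i among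
  the a_j.\<close>

lemma diagm_spectral:
  fixes V W :: "real^'p^'p"
  assumes V: "orthogonal_matrix V" and W: "orthogonal_matrix W"
    and eq: "V ** diagm a ** transpose V = W ** diagm b ** transpose W"
  shows diagm_functional_calculus: "(\<And>i j. a j = b i \<Longrightarrow> f j = g i) \<Longrightarrow>
      V ** diagm f ** transpose V = W ** diagm g ** transpose W"
    and diagm_spectrum_subset: "\<exists>j. a j = b i"
proof -
  note [simp] = orthogonal_matrix_cancel[OF V] orthogonal_matrix_cancel[OF W]
  define X where "X = transpose W ** V"
  have "X ** diagm a = transpose W ** (V ** diagm a ** transpose V) ** V"
    by (simp add: X_def matrix_mul_assoc[symmetric])
  also have "\<dots> = diagm b ** X"
    unfolding eq by (simp add: X_def matrix_mul_assoc[symmetric])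
  finally have "(X ** diagm a) $ i $ j = (diagm b ** X) $ i $ j" for i j by simp
  then have X: "X $ i $ j = 0 \<or> a j = b i" for i j
    by (auto simp: mul_diagm_nth diagm_mul_nth)
  show "V ** diagm f ** transpose V = W ** diagm g ** transpose W"
    if fg: "\<And>i j. a j = b i \<Longrightarrow> f j = g i"
  proof -
    have "(X ** diagm f) $ i $ j = (diagm g ** X) $ i $ j" for i j
      using X[of i j] fg[of j i] by (auto simp: mul_diagm_nth diagm_mul_nth)
    then have "X ** diagm f = diagm g ** X"
      by (simp add: vec_eq_iff)
    then have "W ** (X ** diagm f) ** transpose V = W ** (diagm g ** X) ** transpose V"
      by simp
    then show ?thesis
      by (simp add: X_def matrix_mul_assoc[symmetric])
  qed
  show "\<exists>j. a j = b i"
  proof (rule ccontr)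
    assume "\<nexists>j. a j = b i"
    then have "X $ i $ j = 0" for j using X[of i j] by blast
    then have "(X ** transpose X) $ i $ i = 0"
      by (simp add: matrix_matrix_mult_def)
    moreover have "X ** transpose X = mat 1"
      by (simp add: X_def matrix_transpose_mul matrix_mul_assoc[symmetric])
    ultimately show False by (simp add: mat_def)
  qed
qed

section \<open>The matrix exponential\<close>

lemma mexp_sums:
  fixes A :: "real^'a^'a"
  shows "(\<lambda>k. mpow A k /\<^sub>R fact k) sums mexp A"
proof -
  obtain K where K: "K > 0" "\<And>(A :: real^'a^'a) (B :: real^'a^'a). norm (A ** B) \<le> norm A * norm B * K"
    using matrix_mul.pos_bounded by blast
  have pow: "norm (mpow A k) \<le> norm (mat 1 :: real^'a^'a) * (norm A * K) ^ k" for k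
  proof (induction k)
    case (Suc k)
    have "norm (mpow A (Suc k)) \<le> norm A * norm (mpow A k) * K"
      unfolding mpow.simps by (rule K(2))
    also have "\<dots> \<le> norm A * (norm (mat 1 :: real^'a^'a) * (norm A * K) ^ k) * K"
      using K Suc by (intro mult_right_mono mult_left_mono) auto
    finally show ?case by (simp add: mult_ac)
  qed simp
  have "summable (\<lambda>k. norm (mat 1 :: real^'a^'a) * ((norm A * K) ^ k /\<^sub>R fact k))"
    by (intro summable_mult summable_exp_generic)
  then have "summable (\<lambda>k. mpow A k /\<^sub>R fact k)"
  proof (rule summable_comparison_test')
    fix k show "norm (mpow A k /\<^sub>R fact k) \<le> norm (mat 1 :: real^'a^'a) * ((norm A * K) ^ k /\<^sub>R fact k)"
      using pow[of k] by (simp add: divide_simps)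
  qed
  then show ?thesis unfolding mexp_def by (rule summable_sums)
qed

lemma mpow_commute: "mpow A k ** A = A ** mpow A k"
  by (induction k) (simp_all add: matrix_mul_assoc[symmetric])

lemma mexp_transpose: "mexp (transpose A) = transpose (mexp A)"
proof -
  have "mpow (transpose A) k = transpose (mpow A k)" for k
    by (induction k) (simp_all add: matrix_transpose_mul mpow_commute[symmetric])
  then have "(\<lambda>k. transpose (mpow A k /\<^sub>R fact k)) sums mexp (transpose A)"
    using mexp_sums[of "transpose A"] by (simp add: transpose_scalar)
  moreover have "(\<lambda>k. transpose (mpow A k /\<^sub>R fact k)) sums transpose (mexp A)"
    by (rule bounded_linear.sums[OF bounded_linear_transpose mexp_sums])
  ultimately show ?thesis by (rule sums_unique2)
qed

text \<open>On the plane of \<open>u\<close> and \<open>q\<close> the matrix acts as s times a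
  quarter turn, so the series splits into those of cos and sin. The second hypothesis carries the
  factor \<open>s\<close> because \<open>q\<close> is arbitrary for angle 0.\<close>

lemma mexp_rotation:
  fixes B :: "real^'n^'n"
  assumes u: "B *v u = s *\<^sub>R q" and q: "s *\<^sub>R (B *v q) = - (s\<^sup>2 *\<^sub>R u)"
  shows "mexp B *v u = cos s *\<^sub>R u + sin s *\<^sub>R q"
proof -
  \<comment> \<open>For s = 0 both sides vanish: \<open>sin_coeff 0\<close> is 0, and so is s ^ k
    for k > 0.\<close>
  have Bq: "(sin_coeff k * s ^ k) *\<^sub>R (B *v q) = - ((sin_coeff k * s ^ Suc k) *\<^sub>R u)" for k
  proof (cases "s = 0")
    case True
    then show ?thesis by (cases k) auto
  next
    case False
    have "B *v q = (1/s) *\<^sub>R (s *\<^sub>R (B *v q))" using False by simp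
    then have "B *v q = - (s *\<^sub>R u)" unfolding q using False by (simp add: power2_eq_square)
    then show ?thesis by (simp add: mult_ac)
  qed
  have pow: "mpow B k *v u /\<^sub>R fact k = (cos_coeff k * s ^ k) *\<^sub>R u + (sin_coeff k * s ^ k) *\<^sub>R q" for k
  proof (induction k)
    case (Suc k)
    have "mpow B (Suc k) *v u /\<^sub>R fact (Suc k) = (B *v (mpow B k *v u /\<^sub>R fact k)) /\<^sub>R Suc k"
      by (simp add: matrix_vector_mul_assoc[symmetric] matrix_vector_mult_scaleR)
    also have "\<dots> = ((cos_coeff k * s ^ k) *\<^sub>R (B *v u) + (sin_coeff k * s ^ k) *\<^sub>R (B *v q)) /\<^sub>R Suc k"
      by (simp add: Suc matrix_vector_mult_scaleR matrix_vector_right_distrib)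
    also have "\<dots> = ((cos_coeff k * s ^ Suc k) *\<^sub>R q - (sin_coeff k * s ^ Suc k) *\<^sub>R u) /\<^sub>R Suc k"
      unfolding Bq u by (simp add: mult_ac)
    also have "\<dots> = (cos_coeff (Suc k) * s ^ Suc k) *\<^sub>R u + (sin_coeff (Suc k) * s ^ Suc k) *\<^sub>R q"
      by (simp add: cos_coeff_Suc sin_coeff_Suc scaleR_diff_right divide_inverse mult_ac del: of_nat_Suc power_Suc)
    finally show ?case .
  qed simp
  have "bounded_linear (\<lambda>A :: real^'n^'n. A *v u)"
    unfolding linear_conv_bounded_linear[symmetric] linear_iff
    by (simp add: matrix_vector_mult_add_rdistrib scaleR_matrix_vector_assoc)
  from bounded_linear.sums[OF this mexp_sums]
  have "(\<lambda>k. (mpow B k /\<^sub>R fact k) *v u) sums (mexp B *v u)" .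
  then have "(\<lambda>k. (cos_coeff k * s ^ k) *\<^sub>R u + (sin_coeff k * s ^ k) *\<^sub>R q) sums (mexp B *v u)"
    unfolding pow[symmetric] by (simp add: scaleR_matrix_vector_assoc)
  moreover have "(\<lambda>k. (cos_coeff k * s ^ k) *\<^sub>R u + (sin_coeff k * s ^ k) *\<^sub>R q) sums
      (cos s *\<^sub>R u + sin s *\<^sub>R q)"
    using cos_converges[of s] sin_converges[of s]
    by (intro sums_add sums_scaleR_left) (simp_all add: scaleR_conv_of_real)
  ultimately show ?thesis by (rule sums_unique2)
qed

section \<open>Principal frames of geodesics\<close>

text \<open>The columns of \<open>Q\<close> belonging to vanishing angles are unconstrained apart from being
  orthogonal to \<open>U\<close>, so that no extension to an orthonormal family is needed.\<close>

definition frame :: "real^'p^'n \<Rightarrow> real^'p^'n \<Rightarrow> ('p \<Rightarrow> real) \<Rightarrow> bool" where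
  "frame U Q s \<longleftrightarrow> U \<in> Stiefel \<and> transpose U ** Q = 0 \<and> transpose Q ** Q ** diagm s = diagm s"

text \<open>The Stiefel representative at time 1 of the geodesic with initial lift Q diag(s): one
  plane rotation per column.\<close>

definition rotated :: "real^'p^'n \<Rightarrow> real^'p^'n \<Rightarrow> ('p \<Rightarrow> real) \<Rightarrow> real^'p^'n" where
  "rotated U Q s = U ** diagm (\<lambda>i. cos (s i)) + Q ** diagm (\<lambda>i. sin (s i))"

definition velocity :: "real^'p^'n \<Rightarrow> real^'p^'n \<Rightarrow> ('p \<Rightarrow> real) \<Rightarrow> real^'n^'n" where
  "velocity U Q s = Q ** diagm s ** transpose U + U ** diagm s ** transpose Q"

text \<open>Multiply the Gram condition by the quotients r / s. Only the zero set of the angles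
  matters, so one frame serves the multiples t s, the sines and the reduced angles.\<close>

lemma frame_rescale:
  assumes fr: "frame U Q s" and z: "\<And>i. s i = 0 \<Longrightarrow> r i = 0"
  shows "frame U Q r"
proof -
  have r: "diagm r = diagm s ** diagm (\<lambda>i. r i / s i)"
    unfolding diagm_mult using z by (intro arg_cong[of _ _ diagm] ext) auto
  have "transpose Q ** Q ** diagm r = (transpose Q ** Q ** diagm s) ** diagm (\<lambda>i. r i / s i)"
    by (simp add: r matrix_mul_assoc)
  also have "\<dots> = diagm r" using fr by (simp add: frame_def r)
  finally show ?thesis using fr by (simp add: frame_def)
qed

lemma frame_cancel:
  assumes fr: "frame U Q s"
  shows "transpose U ** U = mat 1" "transpose U ** (U ** X) = X"
    "transpose U ** Q = 0" "transpose U ** (Q ** Y) = 0"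
    "transpose Q ** U = 0" "transpose Q ** (U ** X) = 0"
proof -
  show *: "transpose U ** U = mat 1" and **: "transpose U ** Q = 0"
    using fr by (auto simp: frame_def Stiefel_def)
  show ***: "transpose Q ** U = 0"
    using arg_cong[OF **, of transpose] linear_0[OF bounded_linear.linear[OF bounded_linear_transpose]]
    by (simp add: matrix_transpose_mul)
  show "transpose U ** (U ** X) = X" "transpose U ** (Q ** Y) = 0" "transpose Q ** (U ** X) = 0"
    by (simp_all add: matrix_mul_assoc * ** *** matrix_mul.zero_left)
qed

lemma frame_Q_cancel:
  assumes "frame U Q s" "\<And>i. s i = 0 \<Longrightarrow> r i = 0"
  shows "transpose Q ** (Q ** diagm r) = diagm r"
  using frame_rescale[OF assms] by (simp add: frame_def matrix_mul_assoc)

lemmas matrix_distribs = matrix_mul.add_left matrix_mul.add_right matrix_mul.diff_left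
  matrix_mul.diff_right matrix_mul.minus_left matrix_mul.minus_right
  matrix_mul.zero_left matrix_mul.zero_right matrix_transpose_mul transpose_add transpose_diff
  transpose_minus

lemma rotated_Stiefel:
  assumes fr: "frame U Q s"
  shows "rotated U Q s \<in> Stiefel"
proof -
  have "transpose (rotated U Q s) ** rotated U Q s = diagm (\<lambda>i. cos (s i) * cos (s i) + sin (s i) * sin (s i))"
    by (simp add: rotated_def matrix_distribs matrix_mul_assoc[symmetric] frame_cancel[OF fr]
        frame_Q_cancel[OF fr, of "\<lambda>i. sin (s i)"] diagm_mult diagm_add)
  also have "\<dots> = mat 1"
    by (simp add: diagm_one power2_eq_square[symmetric])
  finally show ?thesis by (simp add: Stiefel_def)
qed

lemma velocity_tangent:
  assumes fr: "frame U Q s"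
  shows "velocity U Q s \<in> Gr_tangent (U ** transpose U)"
  by (simp add: Gr_tangent_def velocity_def matrix_distribs matrix_mul_assoc[symmetric]
      frame_cancel[OF fr])

text \<open>Two terms of the square survive and have equal traces, which the factor 1/2 of the
  metric compensates: the Grassmann norm is the Frobenius norm of the horizontal lift.\<close>

lemma Gr_norm_orthogonal_pair:
  fixes Z Y :: "real^'p^'n"
  assumes Z: "Z \<in> Stiefel" and ZY: "transpose Z ** Y = 0"
  shows "Gr_norm (Y ** transpose Z + Z ** transpose Y) = norm Y"
proof -
  have YZ: "transpose Y ** Z = 0"
    using arg_cong[OF ZY, of transpose] linear_0[OF bounded_linear.linear[OF bounded_linear_transpose]]
    by (simp add: matrix_transpose_mul)
  have 1: "transpose Y ** (Z ** X) = 0" "transpose Z ** (Y ** X) = 0" for X :: "real^'n^'p"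
    by (simp_all add: matrix_mul_assoc YZ ZY matrix_mul.zero_left)
  have "trace ((Y ** transpose Z + Z ** transpose Y) ** (Y ** transpose Z + Z ** transpose Y)) =
     trace (Y ** transpose Y) + trace (Z ** (transpose Y ** (Y ** transpose Z)))"
    by (simp add: matrix_distribs matrix_mul_assoc[symmetric] Stiefel_cancel[OF Z] 1 trace_add add.commute)
  also have "trace (Z ** (transpose Y ** (Y ** transpose Z))) = trace (transpose Y ** Y)"
    by (subst trace_mul_sym) (simp add: matrix_mul_assoc[symmetric] Stiefel_cancel[OF Z])
  also have "trace (Y ** transpose Y) = trace (transpose Y ** Y)"
    by (rule trace_mul_sym)
  finally show ?thesis
    by (simp add: Gr_norm_def Gr_metric_def trace_transpose_mul norm_eq_sqrt_inner)
qed

lemma norm_mul_diagm: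
  assumes "transpose Q ** (Q ** diagm s) = diagm s"
  shows "norm (Q ** diagm s) = L2_set s UNIV"
proof -
  have "(Q ** diagm s) \<bullet> (Q ** diagm s) = trace (diagm s ** diagm s)"
    using assms by (simp add: trace_transpose_mul[symmetric] matrix_transpose_mul matrix_mul_assoc[symmetric])
  then show ?thesis
    by (simp add: norm_eq_sqrt_inner diagm_mult trace_diagm L2_set_def power2_eq_square)
qed

lemma Gr_norm_velocity:
  assumes fr: "frame U Q s"
  shows "Gr_norm (velocity U Q s) = L2_set s UNIV"
proof -
  have "Gr_norm (velocity U Q s) = norm (Q ** diagm s)"
    unfolding velocity_def
    using Gr_norm_orthogonal_pair[of U "Q ** diagm s"] fr frame_cancel[OF fr]
    by (simp add: frame_def matrix_transpose_mul matrix_mul_assoc)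
  with norm_mul_diagm[of Q s] frame_Q_cancel[OF fr, of s] show ?thesis by simp
qed

lemma velocity_eq_0_iff:
  assumes fr: "frame U Q s"
  shows "velocity U Q s = 0 \<longleftrightarrow> (\<forall>i. s i = 0)"
proof
  assume "velocity U Q s = 0"
  then have "L2_set s UNIV = Gr_norm (0 :: real^'b^'b)"
    using Gr_norm_velocity[OF fr] by simp
  then show "\<forall>i. s i = 0"
    by (simp add: Gr_norm_def Gr_metric_def matrix_mul.zero_left trace_def L2_set_eq_0_iff)
next
  assume "\<forall>i. s i = 0"
  then have "diagm s = 0" by (simp add: vec_eq_iff)
  then show "velocity U Q s = 0" by (simp add: velocity_def matrix_distribs)
qed

lemma velocity_scaleR: "velocity U Q (\<lambda>i. c * s i) = c *\<^sub>R velocity U Q s"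
  by (simp add: velocity_def scaleR_diagm[symmetric] matrix_mul.scaleR_left matrix_mul.scaleR_right scaleR_add_right)

lemma velocity_mul_base:
  assumes fr: "frame U Q s"
  shows "velocity U Q s ** U = Q ** diagm s"
  by (simp add: velocity_def matrix_distribs matrix_mul_assoc[symmetric] frame_cancel[OF fr])

text \<open>The commutator \<open>B\<close> is skew and generates the rotation by s_j in the plane
  of the j-th columns of \<open>U\<close> and \<open>Q\<close>. So mexp B takes \<open>U\<close> to
  \<open>rotated U Q s\<close>, and mexp (- B) is its transpose.\<close>

lemma Gr_exp_velocity:
  assumes fr: "frame U Q s"
  shows "Gr_exp (U ** transpose U) (velocity U Q s) = rotated U Q s ** transpose (rotated U Q s)"
proof -
  define B where "B = commutator (velocity U Q s) (U ** transpose U)"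
  have B: "B = Q ** diagm s ** transpose U - U ** diagm s ** transpose Q"
    by (simp add: B_def commutator_def velocity_def matrix_distribs matrix_mul_assoc[symmetric]
      frame_cancel[OF fr])
  have "transpose B = - B"
    by (simp add: B matrix_distribs matrix_mul_assoc[symmetric])
  then have exp_minus: "mexp (- B) = transpose (mexp B)"
    by (metis mexp_transpose)
  have BU: "B ** U = Q ** diagm s"
    by (simp add: B matrix_distribs matrix_mul_assoc[symmetric] frame_cancel[OF fr])
  have BQ: "B ** (Q ** diagm s) = - (U ** diagm (\<lambda>i. s i * s i))"
    by (simp add: B matrix_distribs matrix_mul_assoc[symmetric] frame_cancel[OF fr]
        frame_Q_cancel[OF fr, of s] diagm_mult)
  have "mexp B ** U = rotated U Q s"
  proof (rule matrix_eq_columns)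
    fix j
    have "B *v column j U = s j *\<^sub>R column j Q"
      using arg_cong[OF BU, of "column j"] by (simp add: column_mul column_mul_diagm[symmetric])
    moreover have "s j *\<^sub>R (B *v column j Q) = - ((s j)\<^sup>2 *\<^sub>R column j U)"
    proof -
      have "s j *\<^sub>R (B *v column j Q) = column j (B ** (Q ** diagm s))"
        by (simp only: column_mul[of j B] column_mul_diagm matrix_vector_mult_scaleR)
      also have "\<dots> = - column j (U ** diagm (\<lambda>i. s i * s i))"
        unfolding BQ by (simp add: vec_eq_iff column_def)
      finally show ?thesis by (simp add: column_mul_diagm power2_eq_square)
    qed
    ultimately show "column j (mexp B ** U) = column j (rotated U Q s)"
      by (simp add: column_mul[of j "mexp B"] rotated_def column_add column_mul_diagm mexp_rotation)
  qed
  then show ?thesis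
    by (simp add: Gr_exp_def B_def[symmetric] exp_minus matrix_mul_assoc)
       (metis matrix_mul_assoc matrix_transpose_mul)
qed

text \<open>Since 1 / 0 = 0, a vanishing column of \<open>W\<close> gives a vanishing column of
  \<open>Q\<close>, which the Gram condition of \<open>frame\<close> permits.\<close>

lemma normalize_orthogonal_columns:
  fixes W :: "real^'p^'n"
  assumes gram: "transpose W ** W = diagm (\<lambda>i. r i * r i)"
  defines "Q \<equiv> W ** diagm (\<lambda>i. 1 / r i)"
  shows "Q ** diagm r = W" and "transpose Q ** Q ** diagm r = diagm r"
proof -
  show 1: "Q ** diagm r = W"
  proof (rule matrix_eq_columns)
    fix j
    have "column j (Q ** diagm r) = (r j * (1 / r j)) *\<^sub>R column j W"
      by (simp add: Q_def column_mul_diagm)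
    also have "\<dots> = column j W"
    proof (cases "r j = 0")
      case True
      then have "column j W \<bullet> column j W = 0"
        using arg_cong[OF gram, of "\<lambda>A. A $ j $ j"] by (simp add: transpose_mul_nth)
      then show ?thesis by simp
    qed simp
    finally show "column j (Q ** diagm r) = column j W" .
  qed
  have "transpose Q ** Q ** diagm r = transpose Q ** W"
    by (simp add: matrix_mul_assoc[symmetric] 1)
  also have "\<dots> = diagm (\<lambda>i. 1 / r i) ** (transpose W ** W)"
    by (simp add: Q_def matrix_transpose_mul matrix_mul_assoc)
  also have "\<dots> = diagm (\<lambda>i. 1 / r i * (r i * r i))" by (simp only: gram diagm_mult)
  also have "(\<lambda>i. 1 / r i * (r i * r i)) = r" by auto
  finally show "transpose Q ** Q ** diagm r = diagm r" .
qed

text \<open>A singular value decomposition of the lift D U: \<open>V\<close> diagonalizes its Gram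
  matrix, \<open>s\<close> are the roots of the eigenvalues, \<open>Q\<close> the normalized
  columns.\<close>

lemma tangent_frame:
  fixes U :: "real^'p^'n"
  assumes U: "U \<in> Stiefel" and D: "D \<in> Gr_tangent (U ** transpose U)"
  obtains V Q s where "orthogonal_matrix V" "frame (U ** V) Q s" "\<And>i. s i \<ge> 0"
    "D = velocity (U ** V) Q s"
proof -
  define H where "H = D ** U"
  have sym: "transpose D = D" and eq: "D ** (U ** transpose U) + (U ** transpose U) ** D = D"
    using D by (auto simp: Gr_tangent_def)
  have tH: "transpose H = transpose U ** D"
    by (simp add: H_def matrix_transpose_mul sym)
  \<comment> \<open>Tangency between U^T and U says that U^T D U equals its double, so the lift is
    horizontal.\<close>
  have "transpose U ** H = transpose U ** (D ** (U ** transpose U) + (U ** transpose U) ** D) ** U"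
    by (simp add: eq) (simp add: H_def matrix_mul_assoc)
  also have "\<dots> = transpose U ** H + transpose U ** H"
    by (simp add: H_def matrix_distribs matrix_mul_assoc[symmetric] Stiefel_cancel[OF U])
  finally have UH: "transpose U ** H = 0" by simp
  obtain V a where V: "orthogonal_matrix V" and a: "transpose H ** H = V ** diagm a ** transpose V"
    using symmetric_matrix_diagonalizable[of "transpose H ** H"] by (metis matrix_transpose_mul transpose_transpose)
  note [simp] = orthogonal_matrix_cancel[OF V]
  have gram: "transpose (H ** V) ** (H ** V) = diagm a"
    using a by (simp add: matrix_transpose_mul matrix_mul_assoc[symmetric])
       (simp add: matrix_mul_assoc, simp add: matrix_mul_assoc[symmetric])
  have col: "a i = column i (H ** V) \<bullet> column i (H ** V)" for i
    using arg_cong[OF gram, of "\<lambda>A. A $ i $ i"] by (simp add: transpose_mul_nth)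
  define s where "s i = sqrt (a i)" for i
  define Q where "Q = H ** V ** diagm (\<lambda>i. 1 / s i)"
  have s0: "s i \<ge> 0" for i by (simp add: s_def col)
  have "s i * s i = a i" for i by (simp add: s_def col)
  then have "transpose (H ** V) ** (H ** V) = diagm (\<lambda>i. s i * s i)"
    using gram by simp
  note normalized = normalize_orthogonal_columns[OF this, folded Q_def]
  have Qs: "Q ** diagm s = H ** V" by (rule normalized)
  have "frame (U ** V) Q s"
    unfolding frame_def
  proof (intro conjI)
    show "U ** V \<in> Stiefel" by (rule Stiefel_mul_orthogonal[OF U V])
    have "transpose U ** (H ** X) = 0" for X :: "real^'p^'p"
      by (simp add: matrix_mul_assoc UH matrix_distribs)
    then show "transpose (U ** V) ** Q = 0"
      by (simp add: Q_def matrix_distribs matrix_mul_assoc[symmetric])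
    show "transpose Q ** Q ** diagm s = diagm s" by (rule normalized)
  qed
  moreover have "velocity (U ** V) Q s = D"
  proof -
    have 1: "diagm s ** transpose Q = transpose V ** transpose H"
      using arg_cong[OF Qs, of transpose] by (simp add: matrix_transpose_mul)
    have "velocity (U ** V) Q s = (Q ** diagm s) ** transpose (U ** V) + (U ** V) ** (diagm s ** transpose Q)"
      by (simp add: velocity_def matrix_mul_assoc)
    also have "\<dots> = H ** transpose U + U ** transpose H"
      unfolding 1 Qs by (simp add: matrix_transpose_mul matrix_mul_assoc[symmetric])
    also have "\<dots> = D ** (U ** transpose U) + (U ** transpose U) ** D"
      unfolding tH by (simp add: H_def matrix_mul_assoc)
    finally show ?thesis using eq by simp
  qed
  ultimately show ?thesis using V s0 that by metis
qed

section \<open>Projectors and orthonormal bases of their ranges\<close>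

lemma Stiefel_Grassmann:
  fixes Z :: "real^'p^'n"
  assumes Z: "Z \<in> Stiefel"
  shows "Z ** transpose Z \<in> Grassmann CARD('p)"
proof -
  have "CARD('p) = rank (transpose Z ** Z)"
    by (simp add: Stiefel_cancel[OF Z] rank_I)
  also have "\<dots> \<le> rank (Z ** transpose Z)"
    using rank_mul_le_right[of "transpose Z" "Z"] rank_mul_le_left[of "Z ** transpose Z" Z]
    by (simp add: matrix_mul_assoc[symmetric] Stiefel_cancel[OF Z])
  finally have "CARD('p) \<le> rank (Z ** transpose Z)" .
  moreover have "rank (Z ** transpose Z) \<le> CARD('p)"
    using rank_mul_le_left[of Z "transpose Z"] rank_bound[of Z] by simp
  ultimately show ?thesis
    by (simp add: Grassmann_def matrix_transpose_mul matrix_mul_assoc[symmetric] Stiefel_cancel[OF Z])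
qed

text \<open>\<open>Z\<close> collects an orthonormal basis of the range of \<open>X\<close>. The
  projectors \<open>X\<close> and \<open>M\<close> = Z Z^T fix each other's range; transposing one
  identity shows that X M equals both.\<close>

lemma Grassmann_Stiefel:
  fixes X :: "real^'n^'n"
  assumes X: "X \<in> Grassmann CARD('p::finite)"
  obtains Z :: "real^'p^'n" where "Z \<in> Stiefel" "X = Z ** transpose Z"
proof -
  have sym: "transpose X = X" and idem: "X ** X = X" and rk: "rank X = CARD('p)"
    using X by (auto simp: Grassmann_def)
  define T where "T = range ((*v) X)"
  have "subspace T"
    unfolding T_def by (intro linear_subspace_image matrix_vector_mul_linear subspace_UNIV)
  then obtain B where B: "B \<subseteq> T" "pairwise orthogonal B" "\<And>x. x \<in> B \<Longrightarrow> norm x = 1"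
      "card B = dim T" "independent B" "span B = T"
    using orthonormal_basis_subspace by metis
  have "finite B" "card B = CARD('p)"
    using B independent_imp_finite rk by (auto simp: T_def rank_dim_range)
  then obtain h :: "'p \<Rightarrow> real^'n" where h: "bij_betw h UNIV B"
    using finite_same_card_bij[of "UNIV :: 'p set" B] by auto
  define Z :: "real^'p^'n" where "Z = (\<chi> i j. h j $ i)"
  have col: "column j Z = h j" for j
    by (simp add: Z_def column_def vec_eq_iff)
  have hB: "h j \<in> B" for j using h by (auto simp: bij_betw_def)
  have "h i \<bullet> h j = (if i = j then 1 else 0)" for i j
  proof (cases "i = j")
    case True
    then show ?thesis using B(3)[OF hB[of j]] by (simp add: norm_eq_1)
  next
    case False
    then have "h i \<noteq> h j" using bij_betw_imp_inj_on[OF h] by (simp add: inj_eq)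
    then show ?thesis using B(2) hB[of i] hB[of j] False by (simp add: pairwise_def orthogonal_def)
  qed
  then have Z: "Z \<in> Stiefel"
    by (simp add: Stiefel_def vec_eq_iff transpose_mul_nth col mat_def)
  have XZ: "X ** Z = Z"
  proof (rule matrix_eq_columns)
    fix j
    obtain y where "h j = X *v y" using hB B(1) by (auto simp: T_def)
    then show "column j (X ** Z) = column j Z"
      by (simp add: column_mul col matrix_vector_mul_assoc idem)
  qed
  define M where "M = Z ** transpose Z"
  have "M ** X = X"
  proof (rule matrix_eq_columns)
    fix j
    have "subspace {x. M *v x = x}"
      by (simp add: subspace_def matrix_vector_right_distrib matrix_vector_mult_scaleR)
    moreover have "B \<subseteq> {x. M *v x = x}"
    proof
      fix x assume "x \<in> B"
      then obtain i where "x = column i Z" using h col by (auto simp: bij_betw_def)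
      moreover have "M ** Z = Z" by (simp add: M_def matrix_mul_assoc[symmetric] Stiefel_cancel[OF Z])
      ultimately show "x \<in> {x. M *v x = x}" by (simp add: column_mul[symmetric])
    qed
    ultimately have "T \<subseteq> {x. M *v x = x}"
      using B(6) span_minimal by blast
    moreover have "column j X \<in> T"
      using column_mul[of j X "mat 1"] by (auto simp: T_def)
    ultimately show "column j (M ** X) = column j X" by (auto simp: column_mul)
  qed
  then have "X ** M = X"
    by (metis M_def matrix_transpose_mul sym transpose_transpose)
  moreover have "X ** M = M" by (simp add: M_def matrix_mul_assoc XZ)
  ultimately have "X = Z ** transpose Z" by (simp add: M_def)
  with Z show ?thesis by (rule that)
qed

section \<open>Geodesics\<close>

lemma diagm_eq_sum: "diagm s = (\<Sum>i\<in>UNIV. s i *\<^sub>R diagm (\<lambda>j. if j = i then 1 else 0))"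
  by (simp add: vec_eq_iff sum_component if_distrib[of "(*) _"] cong: if_cong)

lemma diagm_has_vector_derivative:
  assumes "\<And>i. (f i has_real_derivative f' i) (at t)"
  shows "((\<lambda>t. diagm (\<lambda>i. f i t)) has_vector_derivative diagm f') (at t)"
  unfolding diagm_eq_sum[of f'] diagm_eq_sum[of "\<lambda>i. f i _"]
  by (intro has_vector_derivative_sum) (use assms in \<open>auto intro!: derivative_eq_intros\<close>)

lemma continuous_on_diagm:
  assumes "\<And>i. continuous_on S (f i)"
  shows "continuous_on S (\<lambda>t. diagm (\<lambda>i. f i t))"
  unfolding diagm_eq_sum[of "\<lambda>i. f i _"] by (intro continuous_intros assms)

text \<open>\<open>Z\<close> is a horizontal lift, Z^T Z' = 0, so the speed is the Frobenius norm of
  Z', which is constant.\<close>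

lemma geodesic_curve:
  fixes U Q :: "real^'p^'n"
  assumes fr: "frame U Q s" and b: "b \<ge> 0"
  defines "Z \<equiv> \<lambda>t. rotated U Q (\<lambda>i. t * s i)"
  shows "Gr_curve CARD('p) b (\<lambda>t. Z t ** transpose (Z t))"
    and "Gr_length b (\<lambda>t. Z t ** transpose (Z t)) = b * L2_set s UNIV"
proof -
  define Z' where "Z' t = U ** diagm (\<lambda>i. - (s i * sin (t * s i))) + Q ** diagm (\<lambda>i. s i * cos (t * s i))" for t
  define c where "c t = Z t ** transpose (Z t)" for t
  define c' where "c' t = Z' t ** transpose (Z t) + Z t ** transpose (Z' t)" for t
  have St: "Z t \<in> Stiefel" for t
    unfolding Z_def by (rule rotated_Stiefel, rule frame_rescale[OF fr]) simp
  have "(Z has_vector_derivative (U ** diagm (\<lambda>i. - (s i * sin (t * s i))) + 0 ** diagm (\<lambda>i. cos (t * s i))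
      + (Q ** diagm (\<lambda>i. s i * cos (t * s i)) + 0 ** diagm (\<lambda>i. sin (t * s i))))) (at t)" for t
    unfolding Z_def rotated_def
    by (intro has_vector_derivative_add matrix_mul.has_vector_derivative has_vector_derivative_const
        diagm_has_vector_derivative) (auto intro!: derivative_eq_intros)
  then have dZ: "(Z has_vector_derivative Z' t) (at t)" for t
    by (simp add: Z'_def matrix_mul.zero_left)
  have dc: "(c has_vector_derivative c' t) (at t)" for t
  proof -
    have "((\<lambda>t. transpose (Z t)) has_vector_derivative transpose (Z' t)) (at t)"
      by (rule bounded_linear.has_vector_derivative[OF bounded_linear_transpose dZ])
    from matrix_mul.has_vector_derivative[OF dZ this] show ?thesis
      unfolding c_def c'_def by (simp add: add.commute)
  qed
  have contZ: "continuous_on UNIV Z"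
    unfolding Z_def rotated_def
    by (intro continuous_intros continuous_on_diagm matrix_mul.continuous_on)
  have contZ': "continuous_on UNIV Z'"
    unfolding Z'_def
    by (intro continuous_intros continuous_on_diagm matrix_mul.continuous_on)
  have contc': "continuous_on UNIV c'"
    unfolding c'_def
    by (intro continuous_intros matrix_mul.continuous_on contZ contZ'
        bounded_linear.continuous_on[OF bounded_linear_transpose])
  have speed: "Gr_norm (c' t) = L2_set s UNIV" for t
  proof -
    note sims = matrix_distribs matrix_mul_assoc[symmetric] frame_cancel[OF fr]
        frame_Q_cancel[OF fr, of "\<lambda>i. sin (t * s i)"] frame_Q_cancel[OF fr, of "\<lambda>i. s i * cos (t * s i)"]
        diagm_mult diagm_add
    have "transpose (Z t) ** Z' t = diagm (\<lambda>i. - (cos (t * s i) * (s i * sin (t * s i))) + sin (t * s i) * (s i * cos (t * s i)))"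
      by (simp add: Z_def Z'_def rotated_def sims)
    also have "\<dots> = 0" by (simp add: vec_eq_iff)
    finally have "Gr_norm (c' t) = norm (Z' t)"
      unfolding c'_def by (rule Gr_norm_orthogonal_pair[OF St])
    moreover have "Z' t \<bullet> Z' t = trace (transpose (Z' t) ** Z' t)"
      by (simp add: trace_transpose_mul)
    moreover have "transpose (Z' t) ** Z' t = diagm (\<lambda>i. (s i * sin (t * s i)) * (s i * sin (t * s i)) + (s i * cos (t * s i)) * (s i * cos (t * s i)))"
      by (simp add: Z'_def sims)
    moreover have "(s i * sin (t * s i)) * (s i * sin (t * s i)) + (s i * cos (t * s i)) * (s i * cos (t * s i)) = (s i)\<^sup>2" for i
    proof -
      have "(s i * sin (t * s i)) * (s i * sin (t * s i)) + (s i * cos (t * s i)) * (s i * cos (t * s i))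
         = (s i)\<^sup>2 * ((sin (t * s i))\<^sup>2 + (cos (t * s i))\<^sup>2)"
        by (simp add: power2_eq_square algebra_simps
            del: sin_cos_squared_add sin_cos_squared_add2 sin_cos_squared_add3)
      then show ?thesis by simp
    qed
    ultimately show ?thesis
      by (simp add: norm_eq_sqrt_inner trace_diagm L2_set_def)
  qed
  have vd: "vector_derivative c (at t) = c' t" for t
    by (rule vector_derivative_at[OF dc])
  have "c piecewise_C1_differentiable_on {0..b}"
    using dc contc'
    by (intro C1_differentiable_imp_piecewise)
       (auto simp: C1_differentiable_on_def intro: continuous_on_subset)
  moreover have "c t \<in> Grassmann CARD('p)" for t
    unfolding c_def by (rule Stiefel_Grassmann[OF St])
  ultimately show "Gr_curve CARD('p) b (\<lambda>t. Z t ** transpose (Z t))"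
    unfolding c_def[symmetric] Gr_curve_def by (auto simp: vd speed)
  show "Gr_length b (\<lambda>t. Z t ** transpose (Z t)) = b * L2_set s UNIV"
    using b unfolding c_def[symmetric] Gr_length_def by (simp add: vd speed)
qed

section \<open>Aligned Stiefel representatives\<close>

text \<open>Cauchy-Schwarz for the components of \<open>x\<close> and \<open>z\<close> orthogonal to
  \<open>y\<close> bounds their inner product below by the cosine of the angle sum. Inverting the
  cosine needs a sum of at most \<pi>; beyond that, arccos \<le> \<pi> suffices.\<close>

lemma arccos_triangle:
  fixes x y z :: "'a::real_inner"
  assumes "norm x = 1" "norm y = 1" "norm z = 1"
  shows "arccos (x \<bullet> z) \<le> arccos (x \<bullet> y) + arccos (y \<bullet> z)"
proof -
  have bound: "\<bar>v \<bullet> w\<bar> \<le> 1" if "norm v = 1" "norm w = 1" for v w :: 'a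
    using Cauchy_Schwarz_ineq2[of v w] that by simp
  define a b where "a = x \<bullet> y" and "b = y \<bullet> z"
  have ab: "\<bar>a\<bar> \<le> 1" "\<bar>b\<bar> \<le> 1" using assms bound by (auto simp: a_def b_def)
  have sq: "x \<bullet> x = 1" "y \<bullet> y = 1" "z \<bullet> z = 1" using assms by (auto simp: norm_eq_1)
  have "norm (x - a *\<^sub>R y) = sqrt (1 - a\<^sup>2)" "norm (z - b *\<^sub>R y) = sqrt (1 - b\<^sup>2)"
    unfolding norm_eq_sqrt_inner a_def b_def
    by (simp_all add: inner_diff_left inner_diff_right sq inner_commute[of y x] inner_commute[of z y]
        power2_eq_square algebra_simps)
  moreover have "\<bar>(x - a *\<^sub>R y) \<bullet> (z - b *\<^sub>R y)\<bar> \<le> norm (x - a *\<^sub>R y) * norm (z - b *\<^sub>R y)"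
    by (rule Cauchy_Schwarz_ineq2)
  moreover have "(x - a *\<^sub>R y) \<bullet> (z - b *\<^sub>R y) = x \<bullet> z - a * b"
    by (simp add: inner_diff_left inner_diff_right sq a_def b_def algebra_simps)
  ultimately have "\<bar>x \<bullet> z - a * b\<bar> \<le> sqrt (1 - a\<^sup>2) * sqrt (1 - b\<^sup>2)"
    by metis
  then have "a * b - sqrt (1 - a\<^sup>2) * sqrt (1 - b\<^sup>2) \<le> x \<bullet> z"
    by linarith
  then have cos_le: "cos (arccos a + arccos b) \<le> x \<bullet> z"
    using ab by (simp add: cos_add cos_arccos_abs sin_arccos_abs)
  have xz: "\<bar>x \<bullet> z\<bar> \<le> 1" using assms bound by auto
  show ?thesis
  proof (cases "arccos a + arccos b \<le> pi")
    case True
    have "0 \<le> arccos a + arccos b" using ab arccos_lbound by (simp add: abs_le_iff)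
    then have "arccos (cos (arccos a + arccos b)) = arccos a + arccos b"
      using True by (simp add: arccos_cos)
    moreover have "arccos (x \<bullet> z) \<le> arccos (cos (arccos a + arccos b))"
      using cos_le xz by (intro arccos_le_arccos) auto
    ultimately show ?thesis by (simp add: a_def b_def)
  next
    case False
    moreover have "arccos (x \<bullet> z) \<le> pi" using xz by (intro arccos_ubound) auto
    ultimately show ?thesis by (simp add: a_def b_def)
  qed
qed

text \<open>In the half angle x this is x cos x \<le> sin x, squared. As \<open>c\<close> tends to 1
  it approaches the sharp bound 2 (1 - c) for the squared angle, so nothing is lost in the
  limit.\<close>

lemma arccos_squared_le:
  assumes "0 \<le> c" "c \<le> 1"
  shows "(arccos c)\<^sup>2 * (1 + c) \<le> 4 * (1 - c)"
proof -
  define x where "x = arccos c / 2"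
  have x: "0 \<le> x" "x \<le> pi / 2"
    using assms arccos_lbound[of c] arccos_ubound[of c] by (auto simp: x_def)
  have c: "c = cos (2 * x)" using assms by (simp add: x_def)
  have "x * cos x \<le> sin x"
  proof -
    have "sin 0 - 0 * cos 0 \<le> sin x - x * cos x"
    proof (rule DERIV_nonneg_imp_nondecreasing[OF x(1)])
      fix y :: real assume "0 \<le> y" "y \<le> x"
      then show "\<exists>d. ((\<lambda>x. sin x - x * cos x) has_real_derivative d) (at y) \<and> 0 \<le> d"
        using x by (intro exI[of _ "y * sin y"] conjI mult_nonneg_nonneg sin_ge_zero)
          (auto intro!: derivative_eq_intros simp: algebra_simps)
    qed
    then show ?thesis by simp
  qed
  moreover have "0 \<le> x * cos x" using x by (intro mult_nonneg_nonneg cos_ge_zero) auto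
  ultimately have "(x * cos x)\<^sup>2 \<le> (sin x)\<^sup>2" by (rule power_mono)
  moreover have "1 + c = 2 * (cos x)\<^sup>2" "1 - c = 2 * (sin x)\<^sup>2"
    unfolding c by (simp add: cos_double_cos, simp add: cos_double_sin)
  moreover have "arccos c = 2 * x" by (simp add: x_def)
  ultimately show ?thesis by (simp add: power_mult_distrib)
qed

text \<open>Both projectors have squared norm p, and their inner product is |Y^T Z|^2. The value is
  the sum of the squared sines of the principal angles.\<close>

lemma norm_projector_diff:
  fixes Z Y :: "real^'p^'n"
  assumes Z: "Z \<in> Stiefel" and Y: "Y \<in> Stiefel"
  shows "(norm (Y ** transpose Y - Z ** transpose Z))\<^sup>2 / 2 =
    real CARD('p) - trace (transpose (transpose Y ** Z) ** (transpose Y ** Z))"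
proof -
  have self: "trace (transpose (A ** transpose A) ** (A ** transpose A)) = CARD('p)"
    if A: "A \<in> Stiefel" for A :: "real^'p^'n"
  proof -
    have "trace (transpose (A ** transpose A) ** (A ** transpose A)) = trace (A ** transpose A)"
      by (simp add: matrix_transpose_mul matrix_mul_assoc[symmetric] Stiefel_cancel[OF A])
    also have "\<dots> = trace (transpose A ** A)" by (rule trace_mul_sym)
    finally show ?thesis by (simp add: Stiefel_cancel[OF A] trace_I)
  qed
  have "trace (transpose (Y ** transpose Y) ** (Z ** transpose Z)) =
      trace ((Y ** (transpose Y ** Z)) ** transpose Z)"
    by (simp add: matrix_transpose_mul matrix_mul_assoc[symmetric])
  also have "\<dots> = trace (transpose (transpose Y ** Z) ** (transpose Y ** Z))"
    by (subst trace_mul_sym) (simp add: matrix_transpose_mul matrix_mul_assoc[symmetric])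
  finally have cross: "(Y ** transpose Y) \<bullet> (Z ** transpose Z) = \<dots>"
    by (simp only: trace_transpose_mul[symmetric])
  show ?thesis
    using self[OF Z] self[OF Y] cross
    by (simp add: power2_norm_eq_inner inner_diff_left inner_diff_right trace_transpose_mul inner_commute)
qed

text \<open>Polar decomposition: any basis \<open>Y0\<close> of the range of \<open>X\<close> is
  turned by the orthogonal polar factor of Y0^T Z. The matrix Z^T Y then becomes symmetric, with the
  cosines \<open>s\<close> of the principal angles as eigenvalues. The same alignment produces
  \<open>Ystar\<close> from \<open>Y\<close>.\<close>

lemma aligned_representative:
  fixes Z :: "real^'p^'n"
  assumes Z: "Z \<in> Stiefel" and X: "X \<in> Grassmann CARD('p)"
    and close: "\<eta> = (norm (X - Z ** transpose Z))\<^sup>2 / 2" "\<eta> < 1"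
  obtains Y R s where "Y \<in> Stiefel" "Y ** transpose Y = X" "orthogonal_matrix R"
    "transpose Z ** Y = R ** diagm s ** transpose R" "\<And>i. 0 \<le> s i" "\<And>i. s i \<le> 1"
    "(\<Sum>i\<in>UNIV. 1 - (s i)\<^sup>2) = \<eta>"
proof -
  obtain Y0 :: "real^'p^'n" where Y0: "Y0 \<in> Stiefel" "X = Y0 ** transpose Y0"
    using Grassmann_Stiefel[OF X] by blast
  define C where "C = transpose Y0 ** Z"
  obtain R a where R: "orthogonal_matrix R" and a: "transpose C ** C = R ** diagm a ** transpose R"
    using symmetric_matrix_diagonalizable[of "transpose C ** C"]
    by (metis matrix_transpose_mul transpose_transpose)
  note [simp] = orthogonal_matrix_cancel[OF R]
  have RCCR: "transpose (C ** R) ** (C ** R) = diagm a"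
  proof -
    have "transpose (C ** R) ** (C ** R) = transpose R ** (transpose C ** C) ** R"
      by (simp add: matrix_transpose_mul matrix_mul_assoc)
    then show ?thesis unfolding a by (simp add: matrix_mul_assoc[symmetric])
  qed
  have a0: "a i \<ge> 0" for i
    using arg_cong[OF RCCR, of "\<lambda>A. A $ i $ i"] by (simp add: transpose_mul_nth) (metis inner_ge_zero)
  \<comment> \<open>The part of Z R orthogonal to the range of \<open>X\<close>; its Gram matrix
    bounds the squared cosines \<open>a\<close> by 1.\<close>
  define N where "N = (mat 1 - X) ** Z ** R"
  have "transpose N ** N = mat 1 - transpose (C ** R) ** (C ** R)"
    unfolding N_def C_def Y0(2)
    by (simp add: matrix_distribs matrix_mul_assoc[symmetric] Stiefel_cancel[OF Z] Stiefel_cancel[OF Y0(1)])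
  then have NN: "transpose N ** N = diagm (\<lambda>i. 1 - a i)"
    unfolding RCCR by (simp add: vec_eq_iff mat_def)
  have a1: "1 - a i \<ge> 0" for i
    using arg_cong[OF NN, of "\<lambda>A. A $ i $ i"] inner_ge_zero[of "column i N"] by (simp add: transpose_mul_nth)
  have "trace (transpose C ** C) = trace (diagm a)"
    unfolding a by (subst trace_mul_sym) (simp add: matrix_mul_assoc)
  then have sum: "(\<Sum>i\<in>UNIV. 1 - a i) = \<eta>"
    using norm_projector_diff[OF Z Y0(1)]
    by (simp add: close(1) Y0(2) C_def[symmetric] trace_diagm sum_subtractf)
  \<comment> \<open>One squared sine is at most their sum \<eta> < 1, so no cosine vanishes and C^T
    C is invertible.\<close>
  have pos: "a i > 0" for i
  proof -
    have "1 - a i \<le> (\<Sum>i\<in>UNIV. 1 - a i)"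
      using a1 by (intro member_le_sum) auto
    then show ?thesis using sum close(2) by simp
  qed
  define s where "s i = sqrt (a i)" for i
  have s: "s i > 0" "s i \<le> 1" "s i * s i = a i" for i
    using pos[of i] a1[of i] by (auto simp: s_def)
  \<comment> \<open>C (C^T C)^(-1/2), the polar factor of \<open>C\<close>.\<close>
  define W where "W = C ** R ** diagm (\<lambda>i. 1 / s i) ** transpose R"
  have "transpose W ** W = R ** (diagm (\<lambda>i. 1 / s i) ** (transpose (C ** R) ** (C ** R)) ** diagm (\<lambda>i. 1 / s i)) ** transpose R"
    by (simp add: W_def matrix_transpose_mul matrix_mul_assoc)
  also have "\<dots> = R ** diagm (\<lambda>i. 1 / s i * a i * (1 / s i)) ** transpose R"
    unfolding RCCR by (simp only: diagm_mult)
  also have "(\<lambda>i. 1 / s i * a i * (1 / s i)) = (\<lambda>i. 1)"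
    using s(1) unfolding s(3)[symmetric] by (auto simp: less_imp_neq[symmetric])
  finally have W: "orthogonal_matrix W"
    by (simp add: diagm_one orthogonal_matrix)
  have "transpose Z ** (Y0 ** W) = transpose C ** W"
    by (simp add: C_def matrix_transpose_mul matrix_mul_assoc)
  also have "\<dots> = (transpose C ** C) ** R ** diagm (\<lambda>i. 1 / s i) ** transpose R"
    by (simp add: W_def matrix_mul_assoc)
  also have "\<dots> = R ** diagm (\<lambda>i. a i * (1 / s i)) ** transpose R"
    unfolding a by (simp add: matrix_mul_assoc[symmetric] diagm_mult_assoc)
  also have "(\<lambda>i. a i * (1 / s i)) = s"
    using s(1) unfolding s(3)[symmetric] by (auto simp: less_imp_neq[symmetric])
  finally have ZY: "transpose Z ** (Y0 ** W) = R ** diagm s ** transpose R" .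
  have YY: "(Y0 ** W) ** transpose (Y0 ** W) = X"
    by (simp add: Y0(2) matrix_transpose_mul matrix_mul_assoc[symmetric] orthogonal_matrix_cancel[OF W])
  show ?thesis
    by (rule that[OF Stiefel_mul_orthogonal[OF Y0(1) W] YY R ZY])
       (use s sum in \<open>auto simp: less_imp_le power2_eq_square\<close>)
qed

text \<open>The column cosines c_i are averages of the principal cosines s_j with doubly stochastic
  weights R_ij^2: row sums make 1 - c_i an average of the 1 - s_j, column sums add these up again.
  Passing from squared angle to 1 - cos and from there to sin^2 costs a factor \<open>K\<close>
  each, whence K^2 \<eta> under the root.\<close>

lemma aligned_angles_le:
  fixes Z :: "real^'p^'n"
  assumes Z: "Z \<in> Stiefel" and X: "X \<in> Grassmann CARD('p)"
    and close: "\<eta> = (norm (X - Z ** transpose Z))\<^sup>2 / 2" "\<eta> < 1"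
  obtains Y where "Y \<in> Stiefel" "Y ** transpose Y = X"
    "L2_set (\<lambda>i. arccos (column i Z \<bullet> column i Y)) UNIV \<le> 2 / (2 - \<eta>) * sqrt \<eta>"
proof -
  obtain Y R s where Y: "Y \<in> Stiefel" "Y ** transpose Y = X" and R: "orthogonal_matrix R"
    and ZY: "transpose Z ** Y = R ** diagm s ** transpose R"
    and s: "\<And>i. 0 \<le> s i" "\<And>i. s i \<le> 1" and sum: "(\<Sum>i\<in>UNIV. 1 - (s i)\<^sup>2) = \<eta>"
    using aligned_representative[OF Z X close] by metis
  define r where "r i j = (R $ i $ j)\<^sup>2" for i j
  have r0: "r i j \<ge> 0" for i j by (simp add: r_def)
  have "(R ** transpose R) $ i $ i = 1" "(transpose R ** R) $ i $ i = 1" for i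
    by (simp_all add: orthogonal_matrix_cancel[OF R] mat_def)
  then have rows: "(\<Sum>j\<in>UNIV. r i j) = 1" and cols: "(\<Sum>j\<in>UNIV. r j i) = 1" for i
    by (simp_all add: matrix_matrix_mult_def transpose_def r_def power2_eq_square)
  define c where "c i = column i Z \<bullet> column i Y" for i
  have c: "c i = (\<Sum>j\<in>UNIV. r i j * s j)" for i
    unfolding c_def transpose_mul_nth[symmetric] ZY matrix_matrix_mult_def[of "R ** diagm s"]
    by (simp add: mul_diagm_nth transpose_def r_def power2_eq_square mult_ac)
  have eta0: "\<eta> \<ge> 0" by (simp add: close)
  have s_ge: "1 - \<eta> \<le> s j" for j
  proof -
    have "(s i)\<^sup>2 \<le> 1" for i using s[of i] by (simp add: power_le_one)
    then have "1 - (s j)\<^sup>2 \<le> \<eta>"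
      unfolding sum[symmetric] by (intro member_le_sum) auto
    moreover have "(s j)\<^sup>2 \<le> s j" using s[of j] by (simp add: power2_eq_square mult_left_le)
    ultimately show ?thesis by linarith
  qed
  have one_minus_c: "1 - c i = (\<Sum>j\<in>UNIV. r i j * (1 - s j))" for i
    unfolding c by (simp add: algebra_simps sum_subtractf rows)
  have c_ge: "1 - \<eta> \<le> c i" for i
  proof -
    have "(\<Sum>j\<in>UNIV. r i j * (1 - \<eta>)) \<le> c i"
      unfolding c by (intro sum_mono mult_left_mono s_ge r0)
    then show ?thesis by (simp only: sum_distrib_right[symmetric] rows mult_1)
  qed
  have c_le: "c i \<le> 1" for i
    using sum_nonneg[of UNIV "\<lambda>j. r i j * (1 - s j)"] r0 s(2) one_minus_c[of i]
    by (simp add: mult_nonneg_nonneg)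
  \<comment> \<open>All cosines are at least 1 - \<eta>, so 1 + cos is at least 2 - \<eta>.\<close>
  define K where "K = 2 / (2 - \<eta>)"
  have K0: "K \<ge> 0" using close(2) by (simp add: K_def)
  have ang: "(arccos (c i))\<^sup>2 \<le> K * (2 * (1 - c i))" for i
  proof -
    have "(arccos (c i))\<^sup>2 * (2 - \<eta>) \<le> (arccos (c i))\<^sup>2 * (1 + c i)"
      using c_ge[of i] by (intro mult_left_mono) auto
    also have "\<dots> \<le> 4 * (1 - c i)"
      using c_ge[of i] c_le[of i] close(2) by (intro arccos_squared_le) auto
    finally show ?thesis using close(2) by (simp add: K_def field_simps)
  qed
  have sq: "2 * (1 - s j) \<le> K * (1 - (s j)\<^sup>2)" for j
  proof -
    have "2 * (1 - s j) * (2 - \<eta>) \<le> 2 * (1 - s j) * (1 + s j)"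
      using s[of j] s_ge[of j] by (intro mult_left_mono) auto
    then show ?thesis using close(2) by (simp add: K_def field_simps power2_eq_square)
  qed
  have "(\<Sum>i\<in>UNIV. (arccos (c i))\<^sup>2) \<le> (\<Sum>i\<in>UNIV. K * (2 * (1 - c i)))"
    by (intro sum_mono ang)
  also have "\<dots> = K * (\<Sum>i\<in>UNIV. \<Sum>j\<in>UNIV. r i j * (2 * (1 - s j)))"
    unfolding one_minus_c sum_distrib_left by (simp only: mult.left_commute)
  also have "(\<Sum>i\<in>UNIV. \<Sum>j\<in>UNIV. r i j * (2 * (1 - s j))) = (\<Sum>j\<in>UNIV. \<Sum>i\<in>UNIV. r i j * (2 * (1 - s j)))"
    by (rule sum.swap)
  also have "\<dots> = (\<Sum>j\<in>UNIV. 2 * (1 - s j))"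
    by (simp only: sum_distrib_right[symmetric] cols mult_1)
  also have "K * \<dots> \<le> K * (\<Sum>j\<in>UNIV. K * (1 - (s j)\<^sup>2))"
    by (intro mult_left_mono sum_mono sq K0)
  also have "\<dots> = K\<^sup>2 * \<eta>"
    unfolding sum[symmetric] by (simp add: sum_distrib_left power2_eq_square mult_ac)
  finally have "L2_set (\<lambda>i. arccos (c i)) UNIV \<le> sqrt (K\<^sup>2 * \<eta>)"
    unfolding L2_set_def by (rule real_sqrt_le_mono)
  also have "\<dots> = K * sqrt \<eta>" using K0 by (simp add: real_sqrt_mult)
  finally show ?thesis
    using Y that by (simp add: c_def K_def)
qed

section \<open>A lower bound for the length of curves\<close>

lemma Gr_norm_symmetric:
  fixes D :: "real^'n^'n"
  assumes "transpose D = D"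
  shows "norm D = sqrt 2 * Gr_norm D"
  using trace_transpose_mul[of D D] assms
  by (simp add: Gr_norm_def Gr_metric_def norm_eq_sqrt_inner real_sqrt_mult[symmetric])

text \<open>Chord against arc in the Frobenius norm, which is sqrt 2 times \<open>Gr_norm\<close> on
  symmetric matrices; the derivative is symmetric because the curve is.\<close>

lemma Gr_curve_segment:
  fixes c :: "real \<Rightarrow> real^'n^'n"
  assumes c: "Gr_curve p b c" and ab: "0 \<le> u" "u \<le> v" "v \<le> b"
  shows "norm (c v - c u) \<le> sqrt 2 * integral {u..v} (\<lambda>t. Gr_norm (vector_derivative c (at t)))"
proof -
  let ?c' = "\<lambda>t. vector_derivative c (at t)"
  let ?g = "\<lambda>t. Gr_norm (?c' t)"
  have cont: "continuous_on {u..v} c"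
    using c ab unfolding Gr_curve_def piecewise_C1_differentiable_on_def
    by (auto elim: continuous_on_subset)
  obtain S where S: "finite S" "c C1_differentiable_on ({0..b} - S)"
    using c unfolding Gr_curve_def piecewise_C1_differentiable_on_def by blast
  have sym: "transpose (c t) = c t" if "t \<in> {0..b}" for t
    using c that unfolding Gr_curve_def Grassmann_def by blast
  \<comment> \<open>The endpoints join the breakpoints: symmetry of the derivative at t needs
    \<open>c\<close> symmetric near t, and outside {0..b} nothing is known of
    \<open>c\<close>.\<close>
  define N where "N = insert u (insert v S)"
  have finN: "finite N" using S by (simp add: N_def)
  have deriv: "(c has_vector_derivative ?c' t) (at t)" if "t \<in> {u..v} - N" for t
  proof -
    have "t \<in> {0..b} - S" using that ab by (auto simp: N_def)
    then show ?thesis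
      using S(2) unfolding C1_differentiable_on_eq by (simp add: vector_derivative_works)
  qed
  have normc': "norm (?c' t) = sqrt 2 * ?g t" if t: "t \<in> {u..v} - N" for t
  proof -
    have "((\<lambda>t. transpose (c t)) has_vector_derivative transpose (?c' t)) (at t)"
      by (rule bounded_linear.has_vector_derivative[OF bounded_linear_transpose deriv[OF t]])
    then have "(c has_vector_derivative transpose (?c' t)) (at t)"
      by (rule has_vector_derivative_transform_within_open[where S = "{u<..<v}"])
         (use t sym ab in \<open>auto simp: N_def\<close>)
    then have "transpose (?c' t) = ?c' t"
      using deriv[OF t] vector_derivative_unique_at by blast
    then show ?thesis by (rule Gr_norm_symmetric)
  qed
  have "(?c' has_integral (c v - c u)) {u..v}"
    by (rule fundamental_theorem_of_calculus_interior_strong[OF finN ab(2) _ cont])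
       (use deriv in auto)
  \<comment> \<open>Both integrands are set to 0 on \<open>N\<close>, so that the norm bound holds
    at every point.\<close>
  then have I1: "((\<lambda>t. if t \<in> N then 0 else ?c' t) has_integral (c v - c u)) {u..v}"
    by (rule has_integral_spike_finite[OF finN, rotated]) auto
  have "?g integrable_on {u..v}"
    using c ab unfolding Gr_curve_def by (auto elim: integrable_on_subinterval)
  then have "((\<lambda>t. sqrt 2 * ?g t) has_integral sqrt 2 * integral {u..v} ?g) {u..v}"
    by (intro has_integral_mult_right integrable_integral)
  then have I2: "((\<lambda>t. if t \<in> N then 0 else sqrt 2 * ?g t) has_integral sqrt 2 * integral {u..v} ?g) {u..v}"
    by (rule has_integral_spike_finite[OF finN, rotated]) auto
  have "norm (integral {u..v} (\<lambda>t. if t \<in> N then 0 else ?c' t)) \<le>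
      integral {u..v} (\<lambda>t. if t \<in> N then 0 else sqrt 2 * ?g t)"
    using I1 I2 normc' by (intro integral_norm_bound_integral) (auto simp: has_integral_integrable)
  then show ?thesis
    using I1 I2 by (simp add: integral_unique)
qed

lemma Stiefel_column_norm: "Z \<in> Stiefel \<Longrightarrow> norm (column i Z) = 1"
  using transpose_mul_nth[of Z Z i i] by (simp add: Stiefel_def norm_eq_1 mat_def)

text \<open>Discrete horizontal lifting: along a fine partition, each representative is aligned with
  its predecessor. The columns then move on the sphere, and by Minkowski's inequality the total
  of their angles is controlled by the length of the curve.\<close>

lemma Gr_curve_lift:
  fixes U :: "real^'p^'n"
  assumes U: "U \<in> Stiefel" and c: "Gr_curve CARD('p) b c" and b: "b > 0"
    and c0: "c 0 = U ** transpose U" and eta: "0 < \<eta>" "\<eta> < 1"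
  obtains W where "W \<in> Stiefel" "W ** transpose W = c b"
    "L2_set (\<lambda>i. arccos (column i U \<bullet> column i W)) UNIV \<le> 2 / (2 - \<eta>) * Gr_length b c"
proof -
  let ?g = "\<lambda>t. Gr_norm (vector_derivative c (at t))"
  have "continuous_on {0..b} c"
    using c unfolding Gr_curve_def piecewise_C1_differentiable_on_def by blast
  then have "uniformly_continuous_on {0..b} c"
    by (rule compact_uniformly_continuous) simp
  \<comment> \<open>Chords below sqrt (2 \<eta>) keep half the squared chord, the
    \<open>\<eta>'\<close> of each piece, below \<eta>.\<close>
  moreover have "sqrt (2 * \<eta>) > 0" using eta by simp
  ultimately obtain d where d: "d > 0"
    "\<And>x y. x \<in> {0..b} \<Longrightarrow> y \<in> {0..b} \<Longrightarrow> dist y x < d \<Longrightarrow> dist (c y) (c x) < sqrt (2 * \<eta>)"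
    unfolding uniformly_continuous_on_def by metis
  obtain n where n: "b / d < real n"
    using reals_Archimedean2 by blast
  have "0 < b / d" using b d(1) by simp
  then have n0: "0 < real n" using n by linarith
  define h where "h = b / n"
  have h: "0 < h" "h < d" "real n * h = b"
    using n n0 b d(1) by (auto simp: h_def field_simps)
  have "\<exists>W :: real^'p^'n. W \<in> Stiefel \<and> W ** transpose W = c (real k * h) \<and>
      L2_set (\<lambda>i. arccos (column i U \<bullet> column i W)) UNIV \<le> 2 / (2 - \<eta>) * integral {0..real k * h} ?g"
    if "k \<le> n" for k
    using that
  proof (induction k)
    case 0
    have "column i U \<bullet> column i U = 1" for i
      using Stiefel_column_norm[OF U] by (simp add: norm_eq_1)
    then show ?case
      using U c0 by (intro exI[of _ U]) (simp add: L2_set_def)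
  next
    case (Suc k)
    then obtain W :: "real^'p^'n" where W: "W \<in> Stiefel" "W ** transpose W = c (real k * h)"
        "L2_set (\<lambda>i. arccos (column i U \<bullet> column i W)) UNIV \<le> 2 / (2 - \<eta>) * integral {0..real k * h} ?g"
      by auto
    define u v where "u = real k * h" and "v = real (Suc k) * h"
    have "v \<le> real n * h"
      unfolding v_def using Suc.prems h(1) by (intro mult_right_mono) auto
    then have uv: "0 \<le> u" "u \<le> v" "v \<le> b" "v - u = h"
      using h by (auto simp: u_def v_def algebra_simps)
    define \<eta>' where "\<eta>' = (norm (c v - W ** transpose W))\<^sup>2 / 2"
    have "norm (c v - c u) < sqrt (2 * \<eta>)"
      using d(2)[of u v] uv h by (simp add: dist_norm)
    then have "(norm (c v - c u))\<^sup>2 < (sqrt (2 * \<eta>))\<^sup>2"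
      by (intro power_strict_mono) auto
    then have eta': "\<eta>' < \<eta>"
      using eta by (simp add: \<eta>'_def W(2) u_def)
    \<comment> \<open>The sqrt 2 of the chord bound cancels against the 2 in \<open>\<eta>'\<close>,
      leaving the length of the piece.\<close>
    have root: "sqrt \<eta>' \<le> integral {u..v} ?g"
    proof -
      have "sqrt \<eta>' = norm (c v - c u) / sqrt 2"
        by (simp add: \<eta>'_def W(2) u_def real_sqrt_divide)
      then show ?thesis
        using Gr_curve_segment[OF c uv(1-3)] by (simp add: divide_le_eq mult.commute)
    qed
    have cv: "c v \<in> Grassmann CARD('p)"
      using c uv unfolding Gr_curve_def by auto
    have "\<eta>' < 1" using eta eta' by simp
    then obtain Y where Y: "Y \<in> Stiefel" "Y ** transpose Y = c v"
      "L2_set (\<lambda>i. arccos (column i W \<bullet> column i Y)) UNIV \<le> 2 / (2 - \<eta>') * sqrt \<eta>'"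
      using aligned_angles_le[OF W(1) cv \<eta>'_def] by blast
    have cols: "norm (column i U) = 1" "norm (column i W) = 1" "norm (column i Y) = 1" for i
      using Stiefel_column_norm U W(1) Y(1) by auto
    have arc0: "0 \<le> arccos (column i A \<bullet> column i B)"
      if "norm (column i A) = 1" "norm (column i B) = 1" for A B :: "real^'p^'n" and i
      using Cauchy_Schwarz_ineq2[of "column i A" "column i B"] that
      by (intro arccos_lbound) (auto simp: abs_le_iff)
    have "L2_set (\<lambda>i. arccos (column i U \<bullet> column i Y)) UNIV \<le>
        L2_set (\<lambda>i. arccos (column i U \<bullet> column i W) + arccos (column i W \<bullet> column i Y)) UNIV"
      by (intro L2_set_mono arccos_triangle arc0 cols)
    also have "\<dots> \<le> L2_set (\<lambda>i. arccos (column i U \<bullet> column i W)) UNIV +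
        L2_set (\<lambda>i. arccos (column i W \<bullet> column i Y)) UNIV"
      by (rule L2_set_triangle_ineq)
    also have "\<dots> \<le> 2 / (2 - \<eta>) * integral {0..u} ?g + 2 / (2 - \<eta>) * integral {u..v} ?g"
    proof (intro add_mono)
      show "L2_set (\<lambda>i. arccos (column i U \<bullet> column i W)) UNIV \<le> 2 / (2 - \<eta>) * integral {0..u} ?g"
        using W(3) by (simp add: u_def)
      have "2 / (2 - \<eta>') * sqrt \<eta>' \<le> 2 / (2 - \<eta>) * integral {u..v} ?g"
        using eta eta' root by (intro mult_mono divide_left_mono) (auto simp: \<eta>'_def)
      then show "L2_set (\<lambda>i. arccos (column i W \<bullet> column i Y)) UNIV \<le> 2 / (2 - \<eta>) * integral {u..v} ?g"
        using Y(3) by linarith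
    qed
    also have "\<dots> = 2 / (2 - \<eta>) * integral {0..v} ?g"
    proof -
      have "?g integrable_on {0..v}"
        using c uv unfolding Gr_curve_def by (auto elim: integrable_on_subinterval)
      from Henstock_Kurzweil_Integration.integral_combine[OF uv(1,2) this] show ?thesis
        by (metis distrib_left)
    qed
    finally show ?case
      using Y unfolding v_def by blast
  qed
  from this[of n] show ?thesis
    using that h(3) by (auto simp: Gr_length_def)
qed

text \<open>The lift bounds the norm of \<open>s\<close> by 2 / (2 - \<eta>) times the length for
  every \<eta> in (0, 1); then \<eta> tends to 0.\<close>

lemma geodesic_length_le:
  fixes U Q :: "real^'p^'n"
  assumes fr: "frame U Q s" and s: "\<And>i. 0 \<le> s i" "\<And>i. s i \<le> pi / 2"
    and c: "Gr_curve CARD('p) b c" and b: "b > 0" and c0: "c 0 = U ** transpose U"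
    and cb: "c b = rotated U Q s ** transpose (rotated U Q s)"
  shows "L2_set s UNIV \<le> Gr_length b c"
proof -
  define Y where "Y = rotated U Q s"
  have U: "U \<in> Stiefel" using fr by (simp add: frame_def)
  have Y: "Y \<in> Stiefel" unfolding Y_def by (rule rotated_Stiefel[OF fr])
  have UY: "transpose U ** Y = diagm (\<lambda>i. cos (s i))"
    by (simp add: Y_def rotated_def matrix_distribs matrix_mul_assoc[symmetric] frame_cancel[OF fr])
  have bound: "L2_set s UNIV \<le> 2 / (2 - \<eta>) * Gr_length b c" if eta: "0 < \<eta>" "\<eta> < 1" for \<eta>
  proof -
    obtain W where W: "W \<in> Stiefel" "W ** transpose W = c b"
      "L2_set (\<lambda>i. arccos (column i U \<bullet> column i W)) UNIV \<le> 2 / (2 - \<eta>) * Gr_length b c"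
      by (rule Gr_curve_lift[OF U c b c0 eta])
    \<comment> \<open>\<open>W\<close> and \<open>Y\<close> are bases of the same subspace;
      \<open>O'\<close> is the orthogonal matrix between them.\<close>
    define O' where "O' = transpose Y ** W"
    have YO: "W = Y ** O'"
    proof -
      have "W = (W ** transpose W) ** W"
        by (simp add: matrix_mul_assoc[symmetric] Stiefel_cancel[OF W(1)])
      also have "\<dots> = Y ** O'" by (simp add: W(2) cb O'_def Y_def matrix_mul_assoc)
      finally show ?thesis .
    qed
    have "transpose O' ** O' = transpose W ** W"
      by (simp add: YO matrix_transpose_mul matrix_mul_assoc[symmetric] Stiefel_cancel[OF Y])
    then have O: "O' \<in> Stiefel" by (simp add: Stiefel_def Stiefel_cancel[OF W(1)])
    have "s i \<le> arccos (column i U \<bullet> column i W)" for i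
    proof -
      have "norm (O' $ i $ i) \<le> norm (column i O')"
        using component_le_norm_cart[of "column i O'" i] by (simp add: column_def)
      then have o1: "\<bar>O' $ i $ i\<bar> \<le> 1" by (simp add: Stiefel_column_norm[OF O])
      \<comment> \<open>Angles up to \<pi> / 2 enter here: with a negative cosine, a diagonal entry
        of \<open>O'\<close> below 1 would increase the product.\<close>
      have cos0: "0 \<le> cos (s i)" using s[of i] by (intro cos_ge_zero) auto
      have "column i U \<bullet> column i W = (diagm (\<lambda>i. cos (s i)) ** O') $ i $ i"
        unfolding transpose_mul_nth[symmetric] YO UY[symmetric] by (simp add: matrix_mul_assoc)
      also have "\<dots> = cos (s i) * O' $ i $ i" by (simp add: diagm_mul_nth)
      also have "\<dots> \<le> cos (s i)" using cos0 o1 by (intro mult_left_le) auto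
      finally have "column i U \<bullet> column i W \<le> cos (s i)" .
      moreover have "\<bar>column i U \<bullet> column i W\<bar> \<le> 1"
        using Cauchy_Schwarz_ineq2[of "column i U" "column i W"]
        by (simp add: Stiefel_column_norm[OF U] Stiefel_column_norm[OF W(1)])
      ultimately have "arccos (cos (s i)) \<le> arccos (column i U \<bullet> column i W)"
        by (intro arccos_le_arccos) auto
      then show ?thesis using s[of i] by (simp add: arccos_cos)
    qed
    then have "L2_set s UNIV \<le> L2_set (\<lambda>i. arccos (column i U \<bullet> column i W)) UNIV"
      by (intro L2_set_mono s)
    with W(3) show ?thesis by linarith
  qed
  show ?thesis
  proof (rule ccontr)
    define L M where "L = Gr_length b c" and "M = L2_set s UNIV"
    assume "\<not> L2_set s UNIV \<le> Gr_length b c"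
    then have LM: "L < M" by (simp add: L_def M_def)
    have M0: "0 \<le> M" by (simp add: M_def)
    have "L \<ge> 0"
      using bound[of "1/2"] M0 by (simp add: L_def[symmetric] M_def[symmetric])
    \<comment> \<open>Makes M \<eta> half the gap M - L, so that the bound turns into 3 (M - L)
      \<le> 0.\<close>
    define \<eta> where "\<eta> = (M - L) / (2 * M)"
    have eta: "0 < \<eta>" "\<eta> < 1" using LM \<open>L \<ge> 0\<close> by (auto simp: \<eta>_def field_simps)
    have "M * (2 - \<eta>) \<le> 2 * L"
      using bound[OF eta] eta by (simp add: L_def[symmetric] M_def[symmetric] field_simps)
    then have "2 * M - M * \<eta> \<le> 2 * L" by (simp add: right_diff_distrib mult.commute)
    moreover have "M * \<eta> = (M - L) / 2" using LM \<open>L \<ge> 0\<close> by (simp add: \<eta>_def)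
    ultimately have "2 * M - (M - L) / 2 \<le> 2 * L" by simp
    then show False using LM by (simp add: field_simps)
  qed
qed

section \<open>Cut times\<close>

lemma Gr_exp_ray:
  assumes fr: "frame U Q s"
  shows "Gr_exp (U ** transpose U) (t *\<^sub>R velocity U Q s) =
    rotated U Q (\<lambda>i. t * s i) ** transpose (rotated U Q (\<lambda>i. t * s i))"
  unfolding velocity_scaleR[symmetric] by (rule Gr_exp_velocity, rule frame_rescale[OF fr]) simp

lemma rotated_0: "rotated U Q (\<lambda>_. 0) = U"
  by (simp add: rotated_def diagm_one) (simp add: diagm_def zero_vec_def[symmetric] matrix_mul.zero_right)

text \<open>Subtract the nearest multiple k \<pi>; \<open>e\<close> is the sign cos (k \<pi>).
  Angles up to \<pi> / 2 in absolute value stay as they are, so the absolute value never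
  grows.\<close>

lemma reduce_angle:
  obtains r e :: real where "\<bar>r\<bar> \<le> pi / 2" "\<bar>r\<bar> \<le> \<bar>x\<bar>" "e * e = 1" "cos r = e * cos x" "sin r = e * sin x"
proof (cases "\<bar>x\<bar> \<le> pi / 2")
  case True
  then show ?thesis using that[of x 1] by simp
next
  case False
  define k where "k = round (x / pi)"
  define r where "r = x - of_int k * pi"
  have "\<bar>of_int k - x / pi\<bar> \<le> 1 / 2" unfolding k_def by (rule of_int_round_abs_le)
  then have "pi * \<bar>of_int k - x / pi\<bar> \<le> pi * (1 / 2)"
    by (intro mult_left_mono) auto
  also have "pi * \<bar>of_int k - x / pi\<bar> = \<bar>pi * (of_int k - x / pi)\<bar>"
    by (simp add: abs_mult)
  also have "pi * (of_int k - x / pi) = - r" by (simp add: r_def field_simps)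
  finally have r: "\<bar>r\<bar> \<le> pi / 2" by simp
  have sin0: "sin (of_int k * pi) = 0" by (simp add: sin_zero_iff_int2)
  have "(cos (of_int k * pi))\<^sup>2 = 1" using sin_cos_squared_add[of "of_int k * pi"] sin0 by simp
  moreover have "cos r = cos (of_int k * pi) * cos x" "sin r = cos (of_int k * pi) * sin x"
    by (simp_all add: r_def cos_diff sin_diff sin0)
  ultimately show ?thesis
    using r False by (intro that[of r "cos (of_int k * pi)"]) (auto simp: power2_eq_square)
qed

lemma length_minimizing_ray:
  fixes U Q :: "real^'p^'n"
  assumes fr: "frame U Q s" and s: "\<And>i. 0 \<le> s i" and b: "b > 0"
  shows "length_minimizing CARD('p) b (\<lambda>t. Gr_exp (U ** transpose U) (t *\<^sub>R velocity U Q s)) \<longleftrightarrow>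
    (\<forall>i. b * s i \<le> pi / 2)"
proof -
  define c where "c t = rotated U Q (\<lambda>i. t * s i) ** transpose (rotated U Q (\<lambda>i. t * s i))" for t
  have ray: "(\<lambda>t. Gr_exp (U ** transpose U) (t *\<^sub>R velocity U Q s)) = c"
    by (simp add: fun_eq_iff c_def Gr_exp_ray[OF fr])
  have curve: "Gr_curve CARD('p) b c" and len: "Gr_length b c = b * L2_set s UNIV"
    using geodesic_curve[OF fr less_imp_le[OF b]] by (simp_all add: c_def[abs_def])
  have c0: "c 0 = U ** transpose U" by (simp add: c_def rotated_0)
  show ?thesis
    unfolding ray
  proof
    assume small: "\<forall>i. b * s i \<le> pi / 2"
    have "b * L2_set s UNIV \<le> Gr_length b d"
      if "Gr_curve CARD('p) b d" "d 0 = c 0" "d b = c b" for d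
    proof -
      have "L2_set (\<lambda>i. b * s i) UNIV \<le> Gr_length b d"
        using that small s b c0
        by (intro geodesic_length_le[of U Q]) (auto simp: c_def intro: frame_rescale[OF fr])
      then show ?thesis using b by (simp add: L2_set_right_distrib)
    qed
    then show "length_minimizing CARD('p) b c"
      by (simp add: length_minimizing_def curve len)
  next
    assume min: "length_minimizing CARD('p) b c"
    show "\<forall>i. b * s i \<le> pi / 2"
    proof (rule ccontr)
      assume "\<not> (\<forall>i. b * s i \<le> pi / 2)"
      then obtain j where j: "pi / 2 < b * s j" by (auto simp: not_le)
      have "\<forall>i. \<exists>r e :: real. \<bar>r\<bar> \<le> pi / 2 \<and> \<bar>r\<bar> \<le> \<bar>b * s i\<bar> \<and> e * e = 1 \<and>
          cos r = e * cos (b * s i) \<and> sin r = e * sin (b * s i)"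
        by (metis reduce_angle)
      then obtain r e :: "'p \<Rightarrow> real" where re: "\<And>i. \<bar>r i\<bar> \<le> pi / 2" "\<And>i. \<bar>r i\<bar> \<le> \<bar>b * s i\<bar>"
          "\<And>i. e i * e i = 1" "\<And>i. cos (r i) = e i * cos (b * s i)" "\<And>i. sin (r i) = e i * sin (b * s i)"
        by metis
      \<comment> \<open>Vanishing angles stay zero, so the same \<open>Q\<close> serves the
        competitor, which reaches the reduced angles at time \<open>b\<close>.\<close>
      have "r i / b = 0" if "s i = 0" for i
        using re(2)[of i] that by simp
      then have fr': "frame U Q (\<lambda>i. r i / b)"
        by (rule frame_rescale[OF fr])
      define d where "d t = rotated U Q (\<lambda>i. t * (r i / b)) ** transpose (rotated U Q (\<lambda>i. t * (r i / b)))" for t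
      have curve': "Gr_curve CARD('p) b d" and len': "Gr_length b d = b * L2_set (\<lambda>i. r i / b) UNIV"
        using geodesic_curve[OF fr' less_imp_le[OF b]] by (simp_all add: d_def[abs_def])
      have "d 0 = c 0" by (simp add: c0 d_def rotated_0)
      moreover have "d b = c b"
      proof -
        \<comment> \<open>The reduction only flips signs of columns, which leaves the projector onto
          their span unchanged.\<close>
        have "rotated U Q r = rotated U Q (\<lambda>i. b * s i) ** diagm e"
          by (simp add: rotated_def re matrix_distribs matrix_mul_assoc[symmetric] diagm_mult mult.commute)
        then have "rotated U Q r ** transpose (rotated U Q r) =
            rotated U Q (\<lambda>i. b * s i) ** ((diagm e ** diagm e) ** transpose (rotated U Q (\<lambda>i. b * s i)))"
          by (simp add: matrix_transpose_mul matrix_mul_assoc)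
        also have "diagm e ** diagm e = mat 1" by (simp add: diagm_mult re diagm_one)
        finally show ?thesis using b by (simp add: c_def d_def)
      qed
      ultimately have "L2_set s UNIV \<le> L2_set (\<lambda>i. r i / b) UNIV"
        using min curve' b unfolding length_minimizing_def len
        by (metis len' mult_le_cancel_left_pos)
      then have "(\<Sum>i\<in>UNIV. (s i)\<^sup>2) \<le> (\<Sum>i\<in>UNIV. (r i / b)\<^sup>2)"
        by (simp add: L2_set_def)
      moreover have "(\<Sum>i\<in>UNIV. (r i / b)\<^sup>2) < (\<Sum>i\<in>UNIV. (s i)\<^sup>2)"
      proof (rule sum_strict_mono_ex1)
        have *: "\<bar>r i / b\<bar> \<le> \<bar>s i\<bar>" for i
          using re(2)[of i] b by (simp add: abs_mult divide_le_eq mult.commute)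
        then show "\<forall>i\<in>UNIV. (r i / b)\<^sup>2 \<le> (s i)\<^sup>2"
          using abs_le_square_iff by blast
        have "\<bar>r j\<bar> < b * s j" using re(1)[of j] j by linarith
        then have "\<bar>r j / b\<bar> < \<bar>s j\<bar>"
          using b s[of j] by (simp add: divide_less_eq mult.commute)
        then have "(r j / b)\<^sup>2 < (s j)\<^sup>2"
          using power_strict_mono[OF _ abs_ge_zero, of "r j / b" "\<bar>s j\<bar>" 2] unfolding power2_abs by simp
        then show "\<exists>i\<in>UNIV. (r i / b)\<^sup>2 < (s i)\<^sup>2" by blast
      qed simp
      ultimately show False by simp
    qed
  qed
qed

text \<open>With largest angle exactly \<pi> / 2 a ray still minimizes, so the supremum is
  attained.\<close>

lemma cut_time_velocity:
  fixes U Q :: "real^'p^'n"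
  assumes fr: "frame U Q s" and s: "\<And>i. 0 \<le> s i" and M: "\<And>i. s i \<le> s m" "0 < s m"
  shows "cut_time (U ** transpose U) (velocity U Q s) = pi / (2 * s m)"
proof -
  have "U \<in> Stiefel" using fr by (simp add: frame_def)
  from Stiefel_Grassmann[OF this] have rk: "rank (U ** transpose U) = CARD('p)"
    by (simp add: Grassmann_def)
  have "(\<forall>i. b * s i \<le> pi / 2) \<longleftrightarrow> b \<le> pi / (2 * s m)" if "b > 0" for b
  proof
    assume "\<forall>i. b * s i \<le> pi / 2"
    then have "b * s m \<le> pi / 2" by blast
    then show "b \<le> pi / (2 * s m)" using M(2) by (simp add: field_simps)
  next
    assume "b \<le> pi / (2 * s m)"
    then have "b * s m \<le> pi / 2" using M(2) by (simp add: field_simps)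
    moreover have "b * s i \<le> b * s m" for i using M(1) that by (intro mult_left_mono) auto
    ultimately show "\<forall>i. b * s i \<le> pi / 2" by (meson order_trans)
  qed
  then have "{b. b > 0 \<and> length_minimizing (rank (U ** transpose U)) b
      (\<lambda>t. Gr_exp (U ** transpose U) (t *\<^sub>R velocity U Q s))} = {0<..pi / (2 * s m)}"
    unfolding rk using length_minimizing_ray[OF fr s] by auto
  moreover have "0 < pi / (2 * s m)" using M(2) by simp
  ultimately show ?thesis
    unfolding cut_time_def by (simp add: cSup_greaterThanAtMost del: zero_less_divide_iff)
qed

section \<open>The Riemannian logarithm\<close>

lemma exists_max_angle:
  fixes s :: "'p::finite \<Rightarrow> real"
  obtains m where "\<And>i. s i \<le> s m"
proof -
  have "Max (range s) \<in> range s" by (rule Max_in) auto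
  then obtain m where "Max (range s) = s m" by (rule rangeE)
  then show ?thesis using that[of m] by (metis Max_ge finite finite_imageI rangeI)
qed

text \<open>Normalizing divides the angles by the norm \<open>l\<close> and multiplies the cut time
  by \<open>l\<close>, so \<open>l\<close> cancels from the defining inequality.\<close>

lemma velocity_in_injectivity_domain_iff:
  fixes U Q :: "real^'p^'n"
  assumes fr: "frame U Q s" and s: "\<And>i. 0 \<le> s i"
  shows "velocity U Q s \<in> injectivity_domain (U ** transpose U) \<longleftrightarrow> (\<forall>i. s i < pi / 2)"
proof (cases "\<forall>i. s i = 0")
  case True
  then show ?thesis
    using velocity_tangent[OF fr] velocity_eq_0_iff[OF fr] by (simp add: injectivity_domain_def)
next
  case False
  obtain m where m: "\<And>i. s i \<le> s m"
    using exists_max_angle by metis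
  have sm: "0 < s m"
    using False s m by (metis less_eq_real_def order_antisym_conv)
  define l where "l = L2_set s UNIV"
  have "s m \<le> l" unfolding l_def by (rule member_le_L2_set) auto
  then have l: "0 < l" using sm by linarith
  have "cut_time (U ** transpose U) (velocity U Q (\<lambda>i. 1 / l * s i)) = pi / (2 * (1 / l * s m))"
  proof (rule cut_time_velocity)
    show "frame U Q (\<lambda>i. 1 / l * s i)" by (rule frame_rescale[OF fr]) simp
  qed (use s l sm m in \<open>auto intro: divide_right_mono\<close>)
  then have "cut_time (U ** transpose U) (velocity U Q s /\<^sub>R Gr_norm (velocity U Q s)) = l * (pi / 2) / s m"
    unfolding Gr_norm_velocity[OF fr] velocity_scaleR by (simp add: l_def[symmetric] inverse_eq_divide)
  then have "velocity U Q s \<in> injectivity_domain (U ** transpose U) \<longleftrightarrow> l < l * (pi / 2) / s m"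
    using velocity_tangent[OF fr] velocity_eq_0_iff[OF fr] False
    by (simp add: injectivity_domain_def Gr_norm_velocity[OF fr] l_def)
  also have "\<dots> \<longleftrightarrow> l * s m < l * (pi / 2)" using sm by (rule pos_less_divide_eq)
  also have "\<dots> \<longleftrightarrow> s m < pi / 2" using l by (simp only: mult_less_cancel_left_pos)
  also have "\<dots> \<longleftrightarrow> (\<forall>i. s i < pi / 2)" using m by (meson le_less_trans)
  finally show ?thesis .
qed

section \<open>Injectivity of the exponential map for angles below \<pi> / 2\<close>

lemma mul_orthogonal_projector:
  fixes U :: "real^'p^'n" and V :: "real^'p^'p"
  assumes "orthogonal_matrix V"
  shows "(U ** V) ** transpose (U ** V) = U ** transpose U"
  by (simp add: matrix_transpose_mul matrix_mul_assoc[symmetric] orthogonal_matrix_cancel[OF assms])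

lemma tangent_eqI:
  assumes D: "D \<in> Gr_tangent (U ** transpose U)" "D' \<in> Gr_tangent (U ** transpose U)"
    and eq: "D ** U = D' ** U"
  shows "D = D'"
proof -
  have *: "E = (E ** U) ** transpose U + U ** transpose (E ** U)"
    if "E \<in> Gr_tangent (U ** transpose U)" for E
    using that by (simp add: Gr_tangent_def matrix_transpose_mul matrix_mul_assoc[symmetric])
  show ?thesis
    using *[OF D(1)] *[OF D(2)] eq by metis
qed

text \<open>The endpoint F determines U^T F U = V cos^2 V^T and (I - U U^T) F U = Q sin cos V^T.
  Multiplying the latter by V (s / (sin s cos s)) V^T yields the lift Q s V^T, and this factor is a
  function of the former, as cos^2 is injective on [0, \<pi> / 2).\<close>

lemma velocity_eqI:
  fixes U :: "real^'p^'n"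
  assumes V: "orthogonal_matrix V" "orthogonal_matrix V'"
    and fr: "frame (U ** V) Q s" "frame (U ** V') Q' s'"
    and s: "\<And>i. 0 \<le> s i" "\<And>i. s i < pi / 2" and s': "\<And>i. 0 \<le> s' i" "\<And>i. s' i < pi / 2"
    and eq: "rotated (U ** V) Q s ** transpose (rotated (U ** V) Q s) =
      rotated (U ** V') Q' s' ** transpose (rotated (U ** V') Q' s')"
  shows "velocity (U ** V) Q s = velocity (U ** V') Q' s'"
proof -
  have main: "V ** diagm (\<lambda>i. cos (s i) * cos (s i)) ** transpose V = transpose U ** F ** U"
    "velocity (U ** V) Q s ** U = (F ** U - U ** (transpose U ** (F ** U))) **
      (V ** diagm (\<lambda>i. s i / (sin (s i) * cos (s i))) ** transpose V)"
    if V: "orthogonal_matrix V" and fr: "frame (U ** V) Q s"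
      and s: "\<And>i. 0 \<le> s i" "\<And>i. s i < pi / 2"
      and F: "F = rotated (U ** V) Q s ** transpose (rotated (U ** V) Q s)"
    for V Q s F
  proof -
    note V' = orthogonal_matrix_cancel[OF V]
    define Y where "Y = rotated (U ** V) Q s"
    have VU: "transpose V ** (transpose U ** (U ** X)) = transpose V ** X" for X :: "real^'p^'p"
      using frame_cancel(2)[OF fr, of "transpose V ** X"]
      by (simp add: matrix_transpose_mul matrix_mul_assoc[symmetric] V')
    have UU: "transpose U ** (U ** X) = X" for X :: "real^'p^'p"
      using arg_cong[OF VU[of X], of "(**) V"] by (simp add: V')
    have UQ: "transpose U ** Q = 0"
      using arg_cong[OF frame_cancel(3)[OF fr], of "(**) V"]
      by (simp add: matrix_transpose_mul matrix_mul_assoc[symmetric] V' matrix_mul.zero_right)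
    have UY: "transpose U ** Y = V ** diagm (\<lambda>i. cos (s i))"
      by (simp add: Y_def rotated_def matrix_distribs matrix_mul_assoc[symmetric] UU)
         (simp add: matrix_mul_assoc UQ matrix_mul.zero_left)
    have YU: "transpose Y ** U = diagm (\<lambda>i. cos (s i)) ** transpose V"
      using arg_cong[OF UY, of transpose] by (simp add: matrix_transpose_mul)
    have FU: "F ** U = Y ** (diagm (\<lambda>i. cos (s i)) ** transpose V)"
      by (simp add: F Y_def[symmetric] matrix_mul_assoc[symmetric] YU)
    have UFU: "transpose U ** (F ** U) = V ** (diagm (\<lambda>i. cos (s i) * cos (s i)) ** transpose V)"
      unfolding FU by (simp add: matrix_mul_assoc UY) (simp add: matrix_mul_assoc[symmetric] diagm_mult_assoc)
    then show "V ** diagm (\<lambda>i. cos (s i) * cos (s i)) ** transpose V = transpose U ** F ** U"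
      by (simp add: matrix_mul_assoc[symmetric])
    have "F ** U - U ** (transpose U ** (F ** U)) = Q ** (diagm (\<lambda>i. sin (s i) * cos (s i)) ** transpose V)"
      unfolding UFU unfolding FU Y_def rotated_def
      by (simp add: matrix_distribs matrix_mul_assoc[symmetric] diagm_mult_assoc)
    then have "(F ** U - U ** (transpose U ** (F ** U))) ** (V ** diagm (\<lambda>i. s i / (sin (s i) * cos (s i))) ** transpose V)
       = Q ** (diagm (\<lambda>i. (sin (s i) * cos (s i)) * (s i / (sin (s i) * cos (s i)))) ** transpose V)"
      by (simp add: matrix_mul_assoc[symmetric] V' diagm_mult_assoc)
    \<comment> \<open>At angle 0 the product is 0, which is again s_i; elsewhere sin and cos are
      positive.\<close>
    also have "(\<lambda>i. (sin (s i) * cos (s i)) * (s i / (sin (s i) * cos (s i)))) = s"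
    proof
      fix i
      have "0 < cos (s i)" using s[of i] by (intro cos_gt_zero_pi) auto
      moreover have "s i = 0 \<or> 0 < sin (s i)"
        using s[of i] by (cases "s i = 0") (auto intro: sin_gt_zero)
      ultimately show "(sin (s i) * cos (s i)) * (s i / (sin (s i) * cos (s i))) = s i" by auto
    qed
    also have "Q ** (diagm s ** transpose V) = velocity (U ** V) Q s ** (U ** V) ** transpose V"
      using arg_cong[OF velocity_mul_base[OF fr], of "\<lambda>A. A ** transpose V"]
      by (simp add: matrix_mul_assoc)
    also have "\<dots> = velocity (U ** V) Q s ** U"
      by (simp add: matrix_mul_assoc[symmetric] V')
    finally show "velocity (U ** V) Q s ** U = (F ** U - U ** (transpose U ** (F ** U))) **
      (V ** diagm (\<lambda>i. s i / (sin (s i) * cos (s i))) ** transpose V)" ..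
  qed
  note 1 = main[OF V(1) fr(1) s refl] and 2 = main[OF V(2) fr(2) s' eq]
  have "V ** diagm (\<lambda>i. cos (s i) * cos (s i)) ** transpose V =
      V' ** diagm (\<lambda>i. cos (s' i) * cos (s' i)) ** transpose V'"
    using 1(1) 2(1) by simp
  then have "V ** diagm (\<lambda>i. s i / (sin (s i) * cos (s i))) ** transpose V =
      V' ** diagm (\<lambda>i. s' i / (sin (s' i) * cos (s' i))) ** transpose V'"
  proof (rule diagm_functional_calculus[OF V])
    fix i j assume "cos (s j) * cos (s j) = cos (s' i) * cos (s' i)"
    then have "(cos (s j))\<^sup>2 = (cos (s' i))\<^sup>2" by (simp only: power2_eq_square)
    moreover have "0 \<le> cos (s j)" "0 \<le> cos (s' i)"
      using s[of j] s'[of i] by (auto intro: cos_ge_zero)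
    ultimately have "cos (s j) = cos (s' i)" by (simp only: power2_eq_iff_nonneg)
    moreover have "s j \<le> pi" "s' i \<le> pi"
      using s[of j] s'[of i] by linarith+
    ultimately have "s j = s' i"
      using s(1)[of j] s'(1)[of i] by (metis cos_inj_pi)
    then show "s j / (sin (s j) * cos (s j)) = s' i / (sin (s' i) * cos (s' i))" by simp
  qed
  then have "velocity (U ** V) Q s ** U = velocity (U ** V') Q' s' ** U"
    unfolding 1(2) 2(2) by (rule arg_cong)
  moreover have "velocity (U ** V) Q s \<in> Gr_tangent (U ** transpose U)"
    "velocity (U ** V') Q' s' \<in> Gr_tangent (U ** transpose U)"
    using velocity_tangent[OF fr(1)] velocity_tangent[OF fr(2)]
    by (simp_all add: mul_orthogonal_projector V)
  ultimately show ?thesis by (intro tangent_eqI)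
qed

lemma Gr_log_velocity:
  fixes U :: "real^'p^'n"
  assumes U: "U \<in> Stiefel" and V: "orthogonal_matrix V" and fr: "frame (U ** V) Q s"
    and s: "\<And>i. 0 \<le> s i" "\<And>i. s i < pi / 2"
  shows "Gr_log (U ** transpose U) (rotated (U ** V) Q s ** transpose (rotated (U ** V) Q s)) =
    velocity (U ** V) Q s"
  unfolding Gr_log_def
proof (rule the_equality)
  note P = mul_orthogonal_projector[of _ U]
  show "velocity (U ** V) Q s \<in> injectivity_domain (U ** transpose U) \<and>
    Gr_exp (U ** transpose U) (velocity (U ** V) Q s) = rotated (U ** V) Q s ** transpose (rotated (U ** V) Q s)"
    using velocity_in_injectivity_domain_iff[OF fr s(1)] Gr_exp_velocity[OF fr] s(2)
    unfolding P[OF V] by simp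
  fix D
  assume D: "D \<in> injectivity_domain (U ** transpose U) \<and>
    Gr_exp (U ** transpose U) D = rotated (U ** V) Q s ** transpose (rotated (U ** V) Q s)"
  then have "D \<in> Gr_tangent (U ** transpose U)" by (simp add: injectivity_domain_def)
  then obtain V' Q' s' where V': "orthogonal_matrix V'" and fr': "frame (U ** V') Q' s'"
    and s': "\<And>i. 0 \<le> s' i" and D': "D = velocity (U ** V') Q' s'"
    by (rule tangent_frame[OF U]) blast
  have "\<And>i. s' i < pi / 2"
    using velocity_in_injectivity_domain_iff[OF fr' s'] D unfolding P[OF V'] D' by blast
  moreover have "rotated (U ** V') Q' s' ** transpose (rotated (U ** V') Q' s') =
      rotated (U ** V) Q s ** transpose (rotated (U ** V) Q s)"
    using Gr_exp_velocity[OF fr'] D unfolding P[OF V'] D' by simp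
  ultimately show "D = velocity (U ** V) Q s"
    unfolding D' using velocity_eqI[OF V' V fr' fr s' _ s] by blast
qed

text \<open>A largest angle of \<pi> / 2 gives cut time 1. The contrapositive turns the assumption
  that \<open>F\<close> avoids the cut locus into angles strictly below \<pi> / 2.\<close>

lemma cut_locus_velocity:
  fixes U :: "real^'p^'n"
  assumes V: "orthogonal_matrix V" and fr: "frame (U ** V) Q s"
    and s: "\<And>i. 0 \<le> s i" "\<And>i. s i \<le> pi / 2" and m: "s m = pi / 2"
  shows "rotated (U ** V) Q s ** transpose (rotated (U ** V) Q s) \<in> cut_locus (U ** transpose U)"
proof -
  note P = mul_orthogonal_projector[OF V, of U]
  have "0 < s m" unfolding m by simp
  from cut_time_velocity[OF fr s(1) _ this]
  have "cut_time (U ** transpose U) (velocity (U ** V) Q s) = pi / (2 * s m)"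
    using s(2) unfolding P m by blast
  also have "\<dots> = 1" by (simp add: m)
  finally have "rotated (U ** V) Q s ** transpose (rotated (U ** V) Q s) =
    Gr_exp (U ** transpose U) (cut_time (U ** transpose U) (velocity (U ** V) Q s) *\<^sub>R velocity (U ** V) Q s)"
    using Gr_exp_velocity[OF fr] unfolding P by simp
  moreover have "velocity (U ** V) Q s \<noteq> 0"
    using velocity_eq_0_iff[OF fr] \<open>0 < s m\<close> by (metis less_irrefl)
  moreover have "velocity (U ** V) Q s \<in> Gr_tangent (U ** transpose U)"
    using velocity_tangent[OF fr] unfolding P .
  ultimately show ?thesis
    unfolding cut_locus_def by blast
qed

section \<open>The extended Grassmann logarithm\<close>

text \<open>The columns of \<open>W\<close> = Y - U diag(c) are orthogonal to \<open>U\<close> and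
  to each other, with squared norms 1 - c_i^2; normalized, they rotate \<open>U\<close> into
  \<open>Y\<close>.\<close>

lemma principal_angles_frame:
  fixes U Y :: "real^'p^'n"
  assumes U: "U \<in> Stiefel" and Y: "Y \<in> Stiefel" and YU: "transpose Y ** U = diagm c"
    and c: "\<And>i. 0 \<le> c i"
  obtains Q where "frame U Q (\<lambda>i. arccos (c i))" "rotated U Q (\<lambda>i. arccos (c i)) = Y"
    "\<And>i. c i \<le> 1"
proof -
  define W where "W = Y - U ** diagm c"
  have UY: "transpose U ** Y = diagm c"
    using arg_cong[OF YU, of transpose] by (simp add: matrix_transpose_mul)
  have UW: "transpose U ** W = 0"
    by (simp add: W_def matrix_distribs UY Stiefel_cancel[OF U])
  have "transpose W ** W = mat 1 - diagm (\<lambda>i. c i * c i)"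
    by (simp add: W_def matrix_distribs UY YU Stiefel_cancel[OF U] Stiefel_cancel[OF Y]
        matrix_mul_assoc[symmetric] diagm_mult) (simp add: matrix_mul_assoc YU diagm_mult)
  then have gram: "transpose W ** W = diagm (\<lambda>i. 1 - c i * c i)"
    by (simp add: vec_eq_iff mat_def)
  have "0 \<le> 1 - c i * c i" for i
    using arg_cong[OF gram, of "\<lambda>A. A $ i $ i"] inner_ge_zero[of "column i W"]
    by (simp add: transpose_mul_nth)
  then have c1: "c i \<le> 1" for i
    using c[of i] power2_le_imp_le[of "c i" 1] by (simp add: power2_eq_square)
  define r where "r i = sin (arccos (c i))" for i
  have cos: "cos (arccos (c i)) = c i" for i using c[of i] c1[of i] by (intro cos_arccos) auto
  have "r i * r i = 1 - c i * c i" for i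
    using sin_squared_eq[of "arccos (c i)"] by (simp add: r_def cos power2_eq_square)
  then have gram': "transpose W ** W = diagm (\<lambda>i. r i * r i)" using gram by simp
  define Q where "Q = W ** diagm (\<lambda>i. 1 / r i)"
  note normalized = normalize_orthogonal_columns[OF gram', folded Q_def]
  have "transpose U ** Q = 0" by (simp add: Q_def matrix_mul_assoc UW matrix_mul.zero_left)
  then have "frame U Q r"
    using U normalized by (simp add: frame_def)
  then have "frame U Q (\<lambda>i. arccos (c i))"
  proof (rule frame_rescale)
    \<comment> \<open>On [0, \<pi> / 2] the sine vanishes only at 0, so a frame for the sines is one
      for the angles.\<close>
    fix i assume r0: "r i = 0"
    have "0 \<le> arccos (c i)" "arccos (c i) \<le> pi / 2"
      using c[of i] c1[of i] arccos_lbound[of "c i"] arccos_le_pi2[of "c i"] by auto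
    moreover have "\<not> 0 < arccos (c i)"
    proof
      assume "0 < arccos (c i)"
      then have "0 < r i"
        unfolding r_def using \<open>arccos (c i) \<le> pi / 2\<close> pi_gt_zero by (intro sin_gt_zero) linarith+
      then show False using r0 by simp
    qed
    ultimately show "arccos (c i) = 0" by linarith
  qed
  moreover have "rotated U Q (\<lambda>i. arccos (c i)) = Y"
    unfolding rotated_def cos r_def[symmetric] normalized(1) by (simp add: W_def)
  ultimately show ?thesis using c1 that by blast
qed

text \<open>Two decompositions of one matrix X share X^T X = V s^2 V^T, hence V f(s) V^T. If f 0 =
  0, then f(s) = s (f(s) / s) makes Q f(s) V^T the product of X with such a matrix. The weak Gram
  condition covers frames as well as Stiefel matrices.\<close>

lemma singular_functional_calculus:
  fixes Q Q' :: "real^'p^'n"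
  assumes V: "orthogonal_matrix V" "orthogonal_matrix V'"
    and Q: "transpose Q ** Q ** diagm s = diagm s" "transpose Q' ** Q' ** diagm s' = diagm s'"
    and s: "\<And>i. 0 \<le> s i" "\<And>i. 0 \<le> s' i"
    and eq: "Q ** diagm s ** transpose V = Q' ** diagm s' ** transpose V'"
  shows "V ** diagm (\<lambda>i. f (s i)) ** transpose V = V' ** diagm (\<lambda>i. f (s' i)) ** transpose V'"
    and "f 0 = 0 \<Longrightarrow> Q ** diagm (\<lambda>i. f (s i)) ** transpose V = Q' ** diagm (\<lambda>i. f (s' i)) ** transpose V'"
    and "\<exists>j. s j = s' i"
proof -
  define X where "X = Q ** diagm s ** transpose V"
  have gram: "transpose (R ** diagm r ** transpose W) ** (R ** diagm r ** transpose W) =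
      W ** diagm (\<lambda>i. r i * r i) ** transpose W"
    if R: "transpose R ** R ** diagm r = diagm r" for R :: "real^'p^'n" and r and W :: "real^'p^'p"
  proof -
    have "transpose (R ** diagm r ** transpose W) ** (R ** diagm r ** transpose W) =
       W ** (diagm r ** (transpose R ** R ** diagm r)) ** transpose W"
      by (simp add: matrix_transpose_mul matrix_mul_assoc)
    then show ?thesis by (simp add: R diagm_mult)
  qed
  have sq: "V ** diagm (\<lambda>i. s i * s i) ** transpose V = V' ** diagm (\<lambda>i. s' i * s' i) ** transpose V'"
    using gram[OF Q(1), of V] gram[OF Q(2), of V'] unfolding eq by simp
  have inj: "s j = s' i" if "s j * s j = s' i * s' i" for i j
    using that s by (simp add: power2_eq_square[symmetric] power2_eq_iff_nonneg)
  have calc: "V ** diagm (\<lambda>i. g (s i)) ** transpose V = V' ** diagm (\<lambda>i. g (s' i)) ** transpose V'" for g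
    by (rule diagm_functional_calculus[OF V sq]) (metis inj)
  then show "V ** diagm (\<lambda>i. f (s i)) ** transpose V = V' ** diagm (\<lambda>i. f (s' i)) ** transpose V'" .
  show "\<exists>j. s j = s' i"
    using diagm_spectrum_subset[OF V sq, of i] inj by blast
  have split: "R ** diagm (\<lambda>i. f (r i)) ** transpose W =
      (R ** diagm r ** transpose W) ** (W ** diagm (\<lambda>i. f (r i) / r i) ** transpose W)"
    if "f 0 = 0" "orthogonal_matrix W" for R :: "real^'p^'n" and r and W :: "real^'p^'p"
  proof -
    have "(\<lambda>i. f (r i)) = (\<lambda>i. r i * (f (r i) / r i))" using that(1) by (auto simp: fun_eq_iff)
    then show ?thesis
      by (simp add: matrix_mul_assoc[symmetric] orthogonal_matrix_cancel[OF that(2)] diagm_mult_assoc)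
  qed
  show "Q ** diagm (\<lambda>i. f (s i)) ** transpose V = Q' ** diagm (\<lambda>i. f (s' i)) ** transpose V'" if f: "f 0 = 0"
    unfolding split[OF f V(1)] split[OF f V(2)] eq calc[of "\<lambda>x. f x / x"] ..
qed

text \<open>The cosine term has the form V f(s) V^T behind \<open>U\<close>, the sine term Q f(s)
  V^T with sin 0 = 0, so neither depends on the decomposition.\<close>

lemma St_exp_compact_svd:
  assumes svd: "is_compact_svd D Q S V"
  shows "St_exp U D = U ** V ** diag_map cos S ** transpose V + Q ** diag_map sin S ** transpose V"
  unfolding St_exp_def
proof (rule the_equality)
  show "\<exists>Q' S' V'. is_compact_svd D Q' S' V' \<and>
     U ** V ** diag_map cos S ** transpose V + Q ** diag_map sin S ** transpose V =
     U ** V' ** diag_map cos S' ** transpose V' + Q' ** diag_map sin S' ** transpose V'"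
    using svd by blast
  fix Y
  assume "\<exists>Q' S' V'. is_compact_svd D Q' S' V' \<and>
     Y = U ** V' ** diag_map cos S' ** transpose V' + Q' ** diag_map sin S' ** transpose V'"
  then obtain Q' S' V' where svd': "is_compact_svd D Q' S' V'"
    and Y: "Y = U ** V' ** diag_map cos S' ** transpose V' + Q' ** diag_map sin S' ** transpose V'"
    by blast
  obtain s s' where S: "S = diagm s" "S' = diagm s'" and s: "\<And>i. 0 \<le> s i" "\<And>i. 0 \<le> s' i"
    using svd svd' nonneg_diagonal_eq_diagm unfolding is_compact_svd_def nonneg_diagonal_def
    by (metis (no_types, lifting))
  note calc = singular_functional_calculus[of V V' Q s Q' s']
  have hyps: "orthogonal_matrix V" "orthogonal_matrix V'"
    "transpose Q ** Q ** diagm s = diagm s" "transpose Q' ** Q' ** diagm s' = diagm s'"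
    "Q ** diagm s ** transpose V = Q' ** diagm s' ** transpose V'"
    using svd svd' by (auto simp: is_compact_svd_def S Stiefel_def)
  have "V ** diagm (\<lambda>i. cos (s i)) ** transpose V = V' ** diagm (\<lambda>i. cos (s' i)) ** transpose V'"
    "Q ** diagm (\<lambda>i. sin (s i)) ** transpose V = Q' ** diagm (\<lambda>i. sin (s' i)) ** transpose V'"
    using calc(1)[OF hyps(1-4) s hyps(5), of cos] calc(2)[OF hyps(1-4) s hyps(5), of sin] by simp_all
  then show "Y = U ** V ** diag_map cos S ** transpose V + Q ** diag_map sin S ** transpose V"
    unfolding Y S diag_map_diagm by (simp add: matrix_mul_assoc[symmetric])
qed

theorem theorem5p4:
  fixes U Y Ystar Qh :: "real^'p^'n" and P F :: "real^'n^'n"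
    and Qt St Rt Sh R \<Sigma> :: "real^'p^'p"
  assumes "CARD('p) \<le> CARD('n)"
    and "U \<in> Stiefel" and "Y \<in> Stiefel"
    and "P = U ** transpose U" and "P \<in> Grassmann CARD('p)"
    and "F = Y ** transpose Y" and "F \<in> Grassmann CARD('p) - cut_locus P"
    and "is_svd (transpose Y ** U) Qt St Rt"
    and "Ystar = Y ** Qt ** transpose Rt"
    and "is_compact_svd ((mat 1 - U ** transpose U) ** Ystar) Qh Sh R"
    and "\<Sigma> = diag_map arcsin Sh"
  shows "Gr_log P F \<in> Gr_tangent P
    \<and> Qh ** \<Sigma> ** transpose R \<in> St_horizontal U
    \<and> Qh ** \<Sigma> ** transpose R = horizontal_lift U (Gr_log P F)
    \<and> Ystar = St_exp U (horizontal_lift U (Gr_log P F))"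
proof -
  note U = assms(2) and Y = assms(3) and P = assms(4) and F = assms(6)
  define c where "c i = St $ i $ i" for i
  have Qt: "orthogonal_matrix Qt" and Rt: "orthogonal_matrix Rt" and St: "nonneg_diagonal St"
    and YU: "transpose Y ** U = Qt ** St ** transpose Rt"
    using assms(8) by (auto simp: is_svd_def)
  note [simp] = orthogonal_matrix_cancel[OF Qt] orthogonal_matrix_cancel[OF Rt]
  have St_diagm: "St = diagm c" unfolding c_def[abs_def] by (rule nonneg_diagonal_eq_diagm[OF St])
  have c0: "0 \<le> c i" for i using St by (simp add: c_def nonneg_diagonal_def)
  \<comment> \<open>U Rt and Y Qt are principal bases; \<open>Ystar\<close> is the second one turned
    back by Rt^T.\<close>
  have "transpose (Y ** Qt) ** (U ** Rt) = transpose Qt ** (transpose Y ** U) ** Rt"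
    by (simp add: matrix_transpose_mul matrix_mul_assoc)
  also have "\<dots> = diagm c" unfolding YU St_diagm by (simp add: matrix_mul_assoc[symmetric])
  finally have "transpose (Y ** Qt) ** (U ** Rt) = diagm c" .
  then obtain Q where fr: "frame (U ** Rt) Q (\<lambda>i. arccos (c i))"
    and rot: "rotated (U ** Rt) Q (\<lambda>i. arccos (c i)) = Y ** Qt" and c1: "\<And>i. c i \<le> 1"
    using principal_angles_frame[where c = c, OF Stiefel_mul_orthogonal[OF U Rt] Stiefel_mul_orthogonal[OF Y Qt] _ c0]
    by blast
  define \<theta> where "\<theta> i = arccos (c i)" for i
  have fr: "frame (U ** Rt) Q \<theta>" and rot: "rotated (U ** Rt) Q \<theta> = Y ** Qt"
    using fr rot by (simp_all add: \<theta>_def[abs_def])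
  have \<theta>: "0 \<le> \<theta> i" "\<theta> i \<le> pi / 2" for i
    using c0[of i] c1[of i] arccos_lbound[of "c i"] arccos_le_pi2[of "c i"] by (auto simp: \<theta>_def)
  have F_rot: "F = rotated (U ** Rt) Q \<theta> ** transpose (rotated (U ** Rt) Q \<theta>)"
    unfolding rot F by (simp add: mul_orthogonal_projector[OF Qt])
  have \<theta>_less: "\<theta> i < pi / 2" for i
    using cut_locus_velocity[OF Rt fr \<theta>, of i] assms(7) \<theta>(2)[of i] unfolding F_rot P by fastforce
  define D where "D = velocity (U ** Rt) Q \<theta>"
  have log: "Gr_log P F = D"
    unfolding P F_rot D_def by (rule Gr_log_velocity[OF U Rt fr \<theta>(1) \<theta>_less])
  have tangent: "D \<in> Gr_tangent P"
    using velocity_tangent[OF fr] unfolding D_def P mul_orthogonal_projector[OF Rt] .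
  have DU: "D ** U = Q ** diagm \<theta> ** transpose Rt"
    using arg_cong[OF velocity_mul_base[OF fr], of "\<lambda>A. A ** transpose Rt"]
    by (simp add: D_def matrix_mul_assoc[symmetric])
  have UQ: "transpose U ** Q = 0"
    using arg_cong[OF frame_cancel(3)[OF fr], of "(**) Rt"]
    by (simp add: matrix_transpose_mul matrix_mul_assoc[symmetric] matrix_mul.zero_right)
  have UQ': "transpose U ** (Q ** X) = 0" for X :: "real^'p^'p"
    by (simp add: matrix_mul_assoc UQ matrix_mul.zero_left)
  have Ystar: "Ystar = U ** (Rt ** diagm (\<lambda>i. cos (\<theta> i)) ** transpose Rt) + Q ** diagm (\<lambda>i. sin (\<theta> i)) ** transpose Rt"
    unfolding assms(9) rot[symmetric] rotated_def by (simp add: matrix_distribs matrix_mul_assoc)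
  \<comment> \<open>The cosine part lies in the range of \<open>U\<close>, so the compact SVD of the
    procedure has the singular values sin \<theta>, up to order.\<close>
  have proj: "(mat 1 - U ** transpose U) ** Ystar = Q ** diagm (\<lambda>i. sin (\<theta> i)) ** transpose Rt"
    unfolding Ystar
    by (simp add: matrix_distribs matrix_mul_assoc[symmetric] Stiefel_cancel[OF U] UQ')
  define h where "h i = Sh $ i $ i" for i
  have Qh: "Qh \<in> Stiefel" and Sh: "nonneg_diagonal Sh" and R: "orthogonal_matrix R"
    and svd: "Q ** diagm (\<lambda>i. sin (\<theta> i)) ** transpose Rt = Qh ** Sh ** transpose R"
    using assms(10) unfolding proj is_compact_svd_def by auto
  have Sh_diagm: "Sh = diagm h" unfolding h_def[abs_def] by (rule nonneg_diagonal_eq_diagm[OF Sh])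
  have h0: "0 \<le> h i" for i using Sh by (simp add: h_def nonneg_diagonal_def)
  have QhQh: "transpose Qh ** Qh ** diagm r = diagm r" for r
    by (simp add: Stiefel_cancel[OF Qh])
  have "transpose Q ** Q ** diagm (\<lambda>i. sin (\<theta> i)) = diagm (\<lambda>i. sin (\<theta> i))"
    using frame_Q_cancel[OF fr, of "\<lambda>i. sin (\<theta> i)"] by (simp add: matrix_mul_assoc)
  \<comment> \<open>Compares the decomposition by \<open>Q\<close>, \<open>Rt\<close> with the given
    one by \<open>Qh\<close>, \<open>R\<close>; as arcsin 0 = 0, applying arcsin to both yields the
    lift.\<close>
  note calc = singular_functional_calculus[OF Rt R this QhQh _ h0 svd[unfolded Sh_diagm]]
  have sin0: "0 \<le> sin (\<theta> i)" for i using \<theta>[of i] by (intro sin_ge_zero) auto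
  have arcsin_sin: "arcsin (sin (\<theta> i)) = \<theta> i" for i using \<theta>[of i] by (intro arcsin_sin) auto
  define \<sigma> where "\<sigma> i = arcsin (h i)" for i
  have \<Sigma>: "\<Sigma> = diagm \<sigma>" unfolding assms(11) Sh_diagm diag_map_diagm \<sigma>_def[abs_def] ..
  have lift: "D ** U = Qh ** \<Sigma> ** transpose R"
    using calc(2)[OF sin0, of arcsin] unfolding arcsin_sin DU \<Sigma> \<sigma>_def[abs_def] by simp
  \<comment> \<open>Each h_i is the sine of some \<theta>_j, so \<sigma>_i = \<theta>_j; this makes
    \<open>\<Sigma>\<close> admissible in a compact SVD.\<close>
  have \<sigma>0: "0 \<le> \<sigma> i" for i
    using calc(3)[OF sin0, of i] arcsin_sin \<theta>(1) unfolding \<sigma>_def by metis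
  then have "is_compact_svd (D ** U) Qh \<Sigma> R"
    unfolding is_compact_svd_def lift by (simp add: Qh R \<Sigma> nonneg_diagonal_def)
  from St_exp_compact_svd[OF this, of U]
  have "St_exp U (D ** U) = U ** (R ** diagm (\<lambda>i. cos (\<sigma> i)) ** transpose R) + Qh ** diagm (\<lambda>i. sin (\<sigma> i)) ** transpose R"
    unfolding \<Sigma> diag_map_diagm by (simp add: matrix_mul_assoc)
  moreover have Q\<theta>: "transpose Q ** Q ** diagm \<theta> = diagm \<theta>" using fr by (simp add: frame_def)
  \<comment> \<open>The same comparison for the lift itself, now to transfer cos and sin of the
    angles.\<close>
  note calc' = singular_functional_calculus[OF Rt R Q\<theta> QhQh \<theta>(1) \<sigma>0 lift[unfolded DU \<Sigma>]]
  ultimately have "Ystar = St_exp U (D ** U)"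
    unfolding Ystar using calc'(1)[of cos] calc'(2)[of sin] by simp
  moreover have "transpose U ** (D ** U) = 0"
    unfolding DU by (simp add: matrix_mul_assoc[symmetric] UQ')
  ultimately show ?thesis
    using tangent lift by (simp add: log horizontal_lift_def St_horizontal_def)
qed

end
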